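(* Let $n\ge 1$ be an integer, let $d$ be a real number with $n+d>0$, and let $f:\mathbb{R}^n\setminus\{0\}\to\mathbb{R}$ be a measurable function that is homogeneous of degree $d$, i.e. $f(\lambda x_1,\dots,\lambda x_n)=\lambda^d f(x_1,\dots,x_n)$ for all $\lambda>0$, and whose restriction to $\mathbb{S}^{n-1}$ is integrable. Then $$\Gamma\left(\frac{n+d}{2}\right)⨍_{\mathbb{S}^{n-1}} f\,d\sigma = \Gamma\left(\frac n2\right)\mathbb{E}\bigl(f(X_1,\dots,X_n)\bigr),$$ where $X_1,\dots,X_n$ are independent real random variables, each with probability density $\frac{1}{\sqrt{\pi}}e^{-x^2}$ (that is, Gaussian with mean $0$ and variance $1/2$).
   Context: $\mathbb{S}^{n-1}$ is the unit sphere in $\mathbb{R}^n$, $\sigma$ is the standard area measure on it (counting measure if $n=1$), and $⨍_{\mathbb{S}^{n-1}} f\,d\sigma=\frac{1}{\sigma(\mathbb{S}^{n-1})}\int_{\mathbb{S}^{n-1}} f\,d\sigma$ is the average of $f$ over the sphere. *)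

theory Defs
  imports "HOL-Probability.Probability"
begin

(* The m-dimensional Hausdorff measure with its usual normalization
   \<alpha>(m) (diam C / 2)^m, where \<alpha>(m) is the volume of the m-dimensional unit ball.
   For m = 0 every nonempty set has weight 1 (since 0^0 = 1), which gives counting measure;
   this is why the empty set is treated separately.  The covering sets must be required to be
   bounded, because diameter is unspecified on unbounded sets. *)

definition hausdorff_weight :: "nat \<Rightarrow> 'a::metric_space set \<Rightarrow> ennreal" where
  "hausdorff_weight m C =
     (if C = {} then 0 else ennreal (unit_ball_vol (real m) * (diameter C / 2) ^ m))"

definition hausdorff_pre :: "nat \<Rightarrow> real \<Rightarrow> 'a::metric_space set \<Rightarrow> ennreal" where
  "hausdorff_pre m \<delta> A =
     (INF C \<in> {C :: nat \<Rightarrow> 'a set.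
                 A \<subseteq> (\<Union>i. C i) \<and> (\<forall>i. bounded (C i) \<and> diameter (C i) \<le> \<delta>)}.
        \<Sum>i. hausdorff_weight m (C i))"

definition hausdorff_outer :: "nat \<Rightarrow> 'a::metric_space set \<Rightarrow> ennreal" where
  "hausdorff_outer m A = (SUP \<delta> \<in> {0<..}. hausdorff_pre m \<delta> A)"

definition hausdorff_measure :: "nat \<Rightarrow> 'a::metric_space measure" where
  "hausdorff_measure m = measure_of UNIV (sets borel) (hausdorff_outer m)"

(* The area measure of the unit sphere in n-space, as its (n-1)-dimensional Hausdorff measure;
   for n = 1 this is counting measure on the two points of the sphere. *)

definition sphere_area :: "(real ^ 'n) measure" where
  "sphere_area = restrict_space (hausdorff_measure (CARD('n) - 1)) (sphere 0 1)"

definition sphere_average :: "(real ^ 'n \<Rightarrow> real) \<Rightarrow> real" where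
  "sphere_average f =
     (\<integral>x. f x \<partial>sphere_area) / measure (sphere_area :: (real ^ 'n) measure) (sphere 0 1)"

end

theory Submission
  imports Defs
begin

text \<open>
  The Gaussian vector \<open>X\<close> has the rotation invariant density \<open>\<pi>\<^sup>-\<^sup>n\<^sup>/\<^sup>2 exp (- |x|\<^sup>2)\<close>, so its
  direction \<open>X / |X|\<close> is uniform on the sphere and independent of the length \<open>|X|\<close>.  Homogeneity
  gives \<open>f X = |X|\<^sup>d f (X / |X|)\<close>, hence \<open>E (f X)\<close> is the spherical average of \<open>f\<close> times
  \<open>E |X|\<^sup>d\<close>, and the latter moment is \<open>\<Gamma>((n + d) / 2) / \<Gamma>(n / 2)\<close>.

  Two things have to be made precise.  The first is the splitting into direction and length.  The
  uniform distribution on directions is represented by the cone measure, which gives a set \<open>A\<close> of unit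
  vectors the volume of the part of the unit ball that lies over \<open>A\<close>.  Scaling by \<open>r\<close> multiplies
  volume by \<open>r\<^sup>n\<close>, and this alone yields integration in polar coordinates with respect to the cone
  measure (\<open>nn_integral_polar\<close>).

  The second is that the cone measure is a constant multiple of the \<open>(n - 1)\<close>-dimensional Hausdorff
  measure of the sphere.  Averages do not change when the measure is multiplied by a constant, so it
  suffices that both measures are finite, nonzero and invariant under rotations, by
  Christensen's theorem: two finite measures of equal mass for each of which
  all balls of equal radius centred in the support have equal measure coincide
  (\<open>uniform_measures_eq\<close>).  Its proof is a double application of Fubini's theorem together with
  Fatou's lemma.  The local form of the theorem also shows that
  Lebesgue measure is invariant under rotations, since balls of equal radius have equal volume.

  For the Hausdorff measure this leaves three points: it is a Borel measure at all
  (Caratheodory's criterion for metric outer measures); the sphere has finite measure, because a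
  maximal separated set of mesh \<open>e\<close> has only \<open>O(1 / e\<^sup>n\<^sup>-\<^sup>1)\<close> points; and the
  sphere has positive measure, because the cone measure of a ball of radius \<open>e\<close> is
  \<open>O(e\<^sup>n\<^sup>-\<^sup>1)\<close>, so that the mass distribution principle applies.
\<close>

section \<open>Measures that agree on balls\<close>

text \<open>
  Mollify the indicator of \<open>U\<close>: the fraction \<open>N (U \<inter> ball x r) / g r\<close> of a small ball that lies in
  \<open>U\<close> tends to 1 for \<open>x \<in> U\<close>, so Fatou's lemma bounds \<open>M U\<close> by the lower limit of its
  integrals over \<open>M\<close>.  Exchanging the two integrations turns each of these integrals into
  the integral over \<open>y \<in> U\<close> of \<open>M (ball y r) / g r = 1\<close> with respect to \<open>N\<close>.
\<close>

lemma open_emeasure_le_if_equal_on_balls: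
  fixes M N :: "'a::{metric_space, second_countable_topology} measure"
  assumes sets_M [measurable_cong]: "sets M = sets borel"
    and sets_N [measurable_cong]: "sets N = sets borel"
    and "sigma_finite_measure M" "sigma_finite_measure N"
    and S: "AE x in M. x \<in> S" "AE x in N. x \<in> S"
    and M_ball: "\<And>x r. x \<in> S \<Longrightarrow> 0 < r \<Longrightarrow> emeasure M (ball x r) = g r"
    and N_ball: "\<And>x r. x \<in> S \<Longrightarrow> 0 < r \<Longrightarrow> emeasure N (ball x r) = g r"
    and g: "\<And>r. 0 < r \<Longrightarrow> 0 < g r" "\<And>r. 0 < r \<Longrightarrow> g r < \<infinity>"
    and "open U"
  shows "emeasure M U \<le> emeasure N U"
proof -
  interpret M: sigma_finite_measure M by fact
  interpret N: sigma_finite_measure N by fact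
  interpret pair_sigma_finite N M ..
  have [measurable]: "U \<in> sets borel" using \<open>open U\<close> by simp
  define r where "r n = inverse (real (Suc n))" for n
  have r_pos: "r n > 0" for n by (simp add: r_def)
  define F where
    "F n x = (\<integral>\<^sup>+y. indicator U y * indicator {..<r n} (dist x y) \<partial>N) / g (r n)" for n x
  have mF: "F n \<in> borel_measurable M" for n
    unfolding F_def by measurable
  have F_eventually: "eventually (\<lambda>n. F n x = 1) sequentially" if "x \<in> U" "x \<in> S" for x
  proof -
    obtain e where e: "e > 0" "ball x e \<subseteq> U" using \<open>open U\<close> \<open>x \<in> U\<close> open_contains_ball by blast
    have "(\<lambda>n. r n) \<longlonglongrightarrow> 0" unfolding r_def by (rule LIMSEQ_inverse_real_of_nat)
    then have "eventually (\<lambda>n. r n < e) sequentially"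
      using e by (auto dest: order_tendstoD(2))
    then show ?thesis
    proof eventually_elim
      case (elim n)
      have "F n x = (\<integral>\<^sup>+y. indicator (ball x (r n)) y \<partial>N) / g (r n)"
        unfolding F_def using e elim
        by (intro arg_cong2[where f="(/)"] nn_integral_cong refl)
           (auto simp: indicator_def subset_iff)
      also have "\<dots> = 1"
        using N_ball[OF \<open>x \<in> S\<close> r_pos] g[OF r_pos, of n] by (simp add: sets_N ennreal_divide_self)
      finally show ?case .
    qed
  qed
  have bound: "(\<integral>\<^sup>+x. F n x \<partial>M) \<le> emeasure N U" for n
  proof -
    have "(\<integral>\<^sup>+x. F n x \<partial>M)
        = (\<integral>\<^sup>+x. \<integral>\<^sup>+y. indicator U y * indicator {..<r n} (dist x y) \<partial>N \<partial>M) / g (r n)"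
      unfolding F_def by (rule nn_integral_divide) measurable
    also have "(\<integral>\<^sup>+x. \<integral>\<^sup>+y. indicator U y * indicator {..<r n} (dist x y) \<partial>N \<partial>M)
        = (\<integral>\<^sup>+y. \<integral>\<^sup>+x. indicator U y * indicator {..<r n} (dist x y) \<partial>M \<partial>N)"
      by (rule Fubini') measurable
    also have "\<dots> = (\<integral>\<^sup>+y. indicator U y * g (r n) \<partial>N)"
    proof (rule nn_integral_cong_AE)
      show "AE y in N. (\<integral>\<^sup>+x. indicator U y * indicator {..<r n} (dist x y) \<partial>M) = indicator U y * g (r n)"
        using S(2)
      proof eventually_elim
        case (elim y)
        have "(\<integral>\<^sup>+x. indicator U y * indicator {..<r n} (dist x y) \<partial>M)
            = indicator U y * (\<integral>\<^sup>+x. indicator (ball y (r n)) x \<partial>M)"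
          by (subst nn_integral_cmult[symmetric])
             (auto intro!: nn_integral_cong borel_measurable_indicator simp: indicator_def dist_commute sets_M)
        then show ?case using M_ball[OF elim r_pos] by (simp add: sets_M)
      qed
    qed
    also have "\<dots> = emeasure N U * g (r n)"
      by (subst nn_integral_multc) (auto simp: sets_N)
    also have "\<dots> / g (r n) = emeasure N U"
      using g[OF r_pos, of n] by (metis ennreal_mult_divide_eq infinity_ennreal_def neq_top_trans order_less_irrefl less_irrefl mult.commute)
    finally show ?thesis by simp
  qed
  have "emeasure M U = (\<integral>\<^sup>+x. indicator U x \<partial>M)" by (simp add: sets_M)
  also have "\<dots> \<le> (\<integral>\<^sup>+x. liminf (\<lambda>n. F n x) \<partial>M)"
  proof (rule nn_integral_mono_AE)
    show "AE x in M. indicator U x \<le> liminf (\<lambda>n. F n x)"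
      using S(1)
    proof eventually_elim
      case (elim x)
      show ?case
      proof (cases "x \<in> U")
        case True
        then show ?thesis
          using F_eventually[OF True elim] by (intro Liminf_bounded) (auto elim: eventually_mono)
      qed simp
    qed
  qed
  also have "\<dots> \<le> liminf (\<lambda>n. \<integral>\<^sup>+x. F n x \<partial>M)"
    by (intro nn_integral_liminf mF)
  also have "\<dots> \<le> liminf (\<lambda>n. emeasure N U)"
    by (intro Liminf_mono always_eventually allI bound)
  also have "\<dots> = emeasure N U" by (simp add: Liminf_const)
  finally show ?thesis .
qed

lemma sigma_finite_if_balls_finite:
  fixes M :: "'a::metric_space measure"
  assumes "sets M = sets borel" and "\<And>x r. emeasure M (ball x r) < \<infinity>"
  shows "sigma_finite_measure M"
proof
  show "\<exists>A. countable A \<and> A \<subseteq> sets M \<and> \<Union>A = space M \<and> (\<forall>a\<in>A. emeasure M a \<noteq> \<infinity>)"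
  proof (intro exI[of _ "range (\<lambda>n::nat. ball undefined (real n))"] conjI)
    show "\<Union>(range (\<lambda>n::nat. ball undefined (real n))) = space M"
      using sets_eq_imp_space_eq[OF assms(1)] reals_Archimedean2 by auto
  qed (use assms less_top in auto)
qed

text \<open>
  The balls are not stable under intersection, so agreement on them does not extend to the generated
  \<open>\<sigma>\<close>-algebra by a uniqueness argument alone.  The requirement that the measure of a ball does not
  depend on its centre is what makes the comparison on open sets work in both directions.
\<close>

proposition measure_eqI_balls:
  fixes M N :: "'a::{metric_space, second_countable_topology} measure"
  assumes sets: "sets M = sets borel" "sets N = sets borel"
    and fin: "\<And>x r. emeasure M (ball x r) < \<infinity>" "\<And>x r. emeasure N (ball x r) < \<infinity>"
    and S: "AE x in M. x \<in> S" "AE x in N. x \<in> S"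
    and ball: "\<And>x r. x \<in> S \<Longrightarrow> 0 < r \<Longrightarrow> emeasure M (ball x r) = g r"
      "\<And>x r. x \<in> S \<Longrightarrow> 0 < r \<Longrightarrow> emeasure N (ball x r) = g r"
    and g: "\<And>r. 0 < r \<Longrightarrow> 0 < g r" "\<And>r. 0 < r \<Longrightarrow> g r < \<infinity>"
  shows "M = N"
proof -
  have sf: "sigma_finite_measure M" "sigma_finite_measure N"
    by (rule sigma_finite_if_balls_finite; use sets fin in simp)+
  show ?thesis
  proof (rule measure_eqI_generator_eq[where E="{U. open U}" and \<Omega>=UNIV
        and A="\<lambda>n. ball undefined (real n)"])
    show "emeasure M U = emeasure N U" if "U \<in> {U. open U}" for U
      using that by (intro antisym open_emeasure_le_if_equal_on_balls[where S=S and g=g]) (use assms sf in auto)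
    show "sets M = sigma_sets UNIV {U. open U}" "sets N = sigma_sets UNIV {U. open U}"
      by (simp_all add: sets borel_def)
    show "(\<Union>n::nat. ball undefined (real n)) = UNIV"
      using reals_Archimedean2 by auto
    show "emeasure M (ball undefined (real i)) \<noteq> \<infinity>" for i
      using fin(1) less_top by auto
  qed (auto simp: Int_stable_def)
qed

text \<open>
  If one ball centred in the support were null, all of the same radius would be, and countably many
  of them cover the support.
\<close>

lemma emeasure_ball_pos_if_equal_on_balls:
  fixes M :: "'a::{metric_space, second_countable_topology} measure"
  assumes sets: "sets M = sets borel" and S: "AE x in M. x \<in> S"
    and ball: "\<And>x y. x \<in> S \<Longrightarrow> y \<in> S \<Longrightarrow> emeasure M (ball x r) = emeasure M (ball y r)"
    and "emeasure M UNIV > 0" "x \<in> S" "r > 0"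
  shows "emeasure M (ball x r) > 0"
proof (rule ccontr)
  assume "\<not> emeasure M (ball x r) > 0"
  then have null: "ball y r \<in> null_sets M" if "y \<in> S" for y
    using ball[OF that \<open>x \<in> S\<close>] by (auto simp: null_sets_def sets)
  obtain \<F> where \<F>: "\<F> \<subseteq> (\<lambda>y. ball y r) ` S" "countable \<F>" "\<Union>\<F> = \<Union>((\<lambda>y. ball y r) ` S)"
    by (rule Lindelof[of "(\<lambda>y. ball y r) ` S"]) auto
  have "\<Union>\<F> \<in> null_sets M"
    using \<F>(1,2) null by (auto intro!: null_sets_UN' [of \<F> id, simplified])
  then have "AE y in M. y \<notin> \<Union>\<F>" by (rule AE_not_in)
  with S have "AE y in M. False"
    by eventually_elim (use \<F>(3) \<open>r > 0\<close> in auto)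
  then have "emeasure M (space M) = 0" using emeasure_eq_0_AE[where P="\<lambda>_. True" and M=M] by simp
  with \<open>emeasure M UNIV > 0\<close> show False by (simp add: sets_eq_imp_space_eq[OF sets])
qed

text \<open>
  Christensen's theorem for finite measures.  Integrating the indicator of \<open>dist x y < r\<close> over both
  variables in either order shows that the ratio of the measures of a ball equals the ratio of the
  total masses; equal masses thus give measures that agree on balls.
\<close>

proposition uniform_measures_eq:
  fixes M N :: "'a::{metric_space, second_countable_topology} measure"
  assumes sets: "sets M = sets borel" "sets N = sets borel"
    and total: "emeasure M UNIV = emeasure N UNIV" "0 < emeasure M UNIV" "emeasure M UNIV < \<infinity>"
    and S: "AE x in M. x \<in> S" "AE x in N. x \<in> S"
    and ball: "\<And>x y r. x \<in> S \<Longrightarrow> y \<in> S \<Longrightarrow> emeasure M (ball x r) = emeasure M (ball y r)"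
      "\<And>x y r. x \<in> S \<Longrightarrow> y \<in> S \<Longrightarrow> emeasure N (ball x r) = emeasure N (ball y r)"
  shows "M = N"
proof -
  note [measurable_cong] = sets
  have space: "space M = UNIV" "space N = UNIV"
    using sets[THEN sets_eq_imp_space_eq] by auto
  interpret M: finite_measure M using total space by (intro finite_measureI) auto
  interpret N: finite_measure N using total space by (intro finite_measureI) auto
  interpret pair_sigma_finite N M ..
  have "S \<noteq> {}"
  proof
    assume "S = {}"
    with S(1) have "AE x in M. False" by simp
    then have "emeasure M (space M) = 0" using emeasure_eq_0_AE[where P="\<lambda>_. True" and M=M] by simp
    with total show False by (simp add: space)
  qed
  then obtain p where p: "p \<in> S" by blast
  have same: "emeasure M (ball p r) = emeasure N (ball p r)" for r
  proof -
    have "emeasure M (ball p r) * emeasure N UNIV = (\<integral>\<^sup>+y. emeasure M (ball p r) \<partial>N)"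
      by (simp add: space)
    also have "\<dots> = (\<integral>\<^sup>+y. \<integral>\<^sup>+x. indicator {..<r} (dist x y) \<partial>M \<partial>N)"
    proof (rule nn_integral_cong_AE)
      show "AE y in N. emeasure M (ball p r) = (\<integral>\<^sup>+x. indicator {..<r} (dist x y) \<partial>M)"
        using S(2)
      proof eventually_elim
        case (elim y)
        have "(\<integral>\<^sup>+x. indicator {..<r} (dist x y) \<partial>M) = (\<integral>\<^sup>+x. indicator (ball y r) x \<partial>M)"
          by (auto intro!: nn_integral_cong simp: indicator_def dist_commute)
        then show ?case using ball(1)[OF p elim] by (simp add: sets)
      qed
    qed
    also have "\<dots> = (\<integral>\<^sup>+x. \<integral>\<^sup>+y. indicator {..<r} (dist x y) \<partial>N \<partial>M)"
      by (rule Fubini'[symmetric]) measurable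
    also have "\<dots> = (\<integral>\<^sup>+x. emeasure N (ball p r) \<partial>M)"
    proof (rule nn_integral_cong_AE)
      show "AE x in M. (\<integral>\<^sup>+y. indicator {..<r} (dist x y) \<partial>N) = emeasure N (ball p r)"
        using S(1)
      proof eventually_elim
        case (elim x)
        have "(\<integral>\<^sup>+y. indicator {..<r} (dist x y) \<partial>N) = (\<integral>\<^sup>+y. indicator (ball x r) y \<partial>N)"
          by (auto intro!: nn_integral_cong simp: indicator_def)
        then show ?case using ball(2)[OF p elim] by (simp add: sets)
      qed
    qed
    also have "\<dots> = emeasure N (ball p r) * emeasure N UNIV"
      by (simp add: space total)
    finally show ?thesis using total by (auto simp: ennreal_mult_cancel_left mult.commute[of _ "emeasure N UNIV"])
  qed
  show ?thesis
  proof (rule measure_eqI_balls[where S=S and g="\<lambda>r. emeasure M (ball p r)"])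
    show "0 < emeasure M (ball p r)" if "0 < r" for r
      by (rule emeasure_ball_pos_if_equal_on_balls[OF sets(1) S(1) ball(1)]) (use total p that in auto)
    show "emeasure M (ball x r) = emeasure M (ball p r)" if "x \<in> S" for x r
      using ball(1)[OF that p] .
    show "emeasure N (ball x r) = emeasure M (ball p r)" if "x \<in> S" for x r
      using ball(2)[OF that p] same by simp
  qed (use sets S M.emeasure_finite N.emeasure_finite in \<open>auto simp: less_top[symmetric]\<close>)
qed

section \<open>Rotation invariance of Lebesgue measure\<close>

text \<open>
  The image of Lebesgue measure and Lebesgue measure itself give every ball of radius \<open>r\<close> the same
  volume, whatever its centre.
\<close>

proposition distr_lborel_orthogonal:
  fixes T :: "'a::euclidean_space \<Rightarrow> 'a"
  assumes T: "orthogonal_transformation T"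
  shows "distr lborel borel T = lborel"
proof -
  have bij: "bij T" using T by (rule orthogonal_transformation_bij)
  have dist: "dist (T x) (T y) = dist x y" for x y
    using T by (simp add: orthogonal_transformation_isometry)
  have [measurable]: "T \<in> borel_measurable borel"
    using T by (intro borel_measurable_continuous_onI linear_continuous_on linear_conv_bounded_linear[THEN iffD1] orthogonal_transformation_linear)
  have balls: "emeasure (distr lborel borel T) (ball x r) = emeasure lborel (ball (inv T x) r)" for x r
  proof -
    have "T (inv T x) = x" using bij by (simp add: bij_is_surj surj_f_inv_f)
    then have "T -` ball x r = ball (inv T x) r"
      using dist[of "inv T x"] by (auto)
    then show ?thesis by (simp add: emeasure_distr)
  qed
  have fin: "emeasure lborel (ball x r) < \<infinity>" for x :: 'a and r
    using emeasure_lborel_ball_finite by blast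
  show ?thesis
  proof (rule measure_eqI_balls[where S=UNIV and g="\<lambda>r. emeasure lborel (ball (0::'a) r)"])
    show "emeasure (distr lborel borel T) (ball x r) < \<infinity>" for x r
      using fin by (simp add: balls)
  qed (use fin in \<open>auto simp: balls emeasure_ball\<close>)
qed

section \<open>Metric outer measures\<close>

lemma tendsto_suminf_tail_ennreal:
  fixes f :: "nat \<Rightarrow> ennreal"
  assumes "(\<Sum>i. f i) < \<infinity>"
  shows "(\<lambda>k. \<Sum>i. f (i + k)) \<longlonglongrightarrow> 0"
proof -
  have fin: "f i \<noteq> \<infinity>" for i
    using ennreal_suminf_lessD[OF assms] by (auto simp: less_top)
  define r where "r i = enn2real (f i)" for i
  have r: "f i = ennreal (r i)" "r i \<ge> 0" for i
    using fin[of i] by (auto simp: r_def less_top)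
  have "summable r"
    using assms r by (intro summable_suminf_not_top) (auto simp: less_top)
  then have sm: "summable (\<lambda>i. r (i + k))" for k by (simp add: summable_iff_shift)
  have "(\<Sum>i. f (i + k)) = ennreal (\<Sum>i. r (i + k))" for k
    using r sm by (simp add: suminf_ennreal2)
  moreover have "(\<lambda>k. \<Sum>i. r (i + k)) \<longlonglongrightarrow> 0"
    using \<open>summable r\<close> by (rule suminf_exist_split2)
  ultimately show ?thesis by (simp add: tendsto_ennreal_iff flip: ennreal_0)
qed

text \<open>
  Caratheodory's criterion.  A closed set \<open>F\<close> has to split every set \<open>A\<close> additively.  The points of
  \<open>A\<close> at distance at least \<open>1 / (k + 1)\<close> from \<open>F\<close>, the set \<open>D k\<close> below, are separated from
  \<open>A \<inter> F\<close>, so only the limit \<open>k \<rightarrow> \<infinity>\<close> is at stake.  What \<open>D k\<close> misses of \<open>A - F\<close> is the union of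
  the shells \<open>R i\<close> with \<open>i \<ge> k\<close>.  Shells whose indices differ by at least two are separated from each
  other, so the sums over the even and over the odd shells are each at most \<open>\<phi> A\<close>; therefore the
  sum over all shells converges and its tail vanishes in the limit.
\<close>

proposition metric_outer_measure_imp_measure_space_borel:
  fixes \<phi> :: "'a::metric_space set \<Rightarrow> ennreal"
  assumes \<phi>_empty: "\<phi> {} = 0" and \<phi>_mono: "\<And>A B. A \<subseteq> B \<Longrightarrow> \<phi> A \<le> \<phi> B"
    and \<phi>_UN: "\<And>A :: nat \<Rightarrow> _. \<phi> (\<Union>i. A i) \<le> (\<Sum>i. \<phi> (A i))"
    and sep: "\<And>A B e. 0 < e \<Longrightarrow> (\<And>x y. x \<in> A \<Longrightarrow> y \<in> B \<Longrightarrow> e \<le> dist x y) \<Longrightarrow> \<phi> A + \<phi> B \<le> \<phi> (A \<union> B)"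
  shows "measure_space UNIV (sets borel) \<phi>"
proof -
  have outer: "outer_measure_space UNIV \<phi>"
    unfolding outer_measure_space_def positive_def increasing_def countably_subadditive_def
    using assms by auto
  have \<phi>_Un: "\<phi> (A \<union> B) \<le> \<phi> A + \<phi> B" for A B
    using \<phi>_UN[of "binaryset A B"] \<phi>_empty
    by (simp add: UN_binaryset_eq suminf_binaryset_eq comp_def)
  have interp: "sigma_algebra (UNIV :: 'a set) UNIV"
    using sigma_algebra_Pow[of UNIV] by simp
  define L where "L = lambda_system UNIV UNIV \<phi>"
  have L: "measure_space UNIV L \<phi>"
    unfolding L_def by (rule sigma_algebra.caratheodory_lemma[OF interp outer])
  have closed_L: "F \<in> L" if "closed F" for F
  proof -
    have le: "\<phi> (A \<inter> F) + \<phi> (A - F) \<le> \<phi> A" for A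
    proof (cases "F = {} \<or> \<phi> A = \<infinity>")
      case True
      then show ?thesis using \<phi>_empty by auto
    next
      case False
      then have "F \<noteq> {}" and fin: "\<phi> A < \<infinity>" by (auto simp: less_top)
      define D where "D k = {x \<in> A. 1 / real (Suc k) \<le> infdist x F}" for k
      define R where "R k = D (Suc k) - D k" for k
      have dist_ge: "infdist x F - infdist y F \<le> dist x y" for x y
        using infdist_triangle[of x F y] by (simp add: algebra_simps)
      have R_le: "1 / real (Suc (Suc k)) \<le> infdist x F" if "x \<in> R k" for x k
        using that by (auto simp: R_def D_def)
      have R_less: "infdist x F < 1 / real (Suc k)" if "x \<in> R k" for x k
        using that by (auto simp: R_def D_def)
      \<comment> \<open>One statement for both parities: \<open>j = 0\<close> gives the even shells, \<open>j = 1\<close> the odd ones.\<close>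
      have partial: "(\<Sum>k<K. \<phi> (R (2 * k + j))) \<le> \<phi> (\<Union>k<K. R (2 * k + j))" for K j
      proof (induction K)
        case (Suc K)
        have "(\<Sum>k<Suc K. \<phi> (R (2 * k + j))) \<le> \<phi> (\<Union>k<K. R (2 * k + j)) + \<phi> (R (2 * K + j))"
          using Suc by (simp add: add_right_mono)
        also have "\<dots> \<le> \<phi> ((\<Union>k<K. R (2 * k + j)) \<union> R (2 * K + j))"
        proof (cases "K = 0")
          case True
          then show ?thesis by (simp add: \<phi>_empty)
        next
          case False
          show ?thesis
          proof (rule sep)
            show "0 < 1 / real (2 * K + j) - 1 / real (2 * K + j + 1)"
              unfolding diff_gt_0_iff_gt using False by (intro divide_strict_left_mono) auto
            fix x y assume "x \<in> (\<Union>k<K. R (2 * k + j))" and y: "y \<in> R (2 * K + j)"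
            then obtain k where k: "k < K" "x \<in> R (2 * k + j)" by blast
            have "1 / real (2 * K + j) \<le> 1 / real (Suc (Suc (2 * k + j)))"
              using k by (intro divide_left_mono) auto
            also have "\<dots> \<le> infdist x F" using R_le k by blast
            finally show "1 / real (2 * K + j) - 1 / real (2 * K + j + 1) \<le> dist x y"
              using R_less[OF y] dist_ge[of x y] by simp
          qed
        qed
        also have "(\<Union>k<K. R (2 * k + j)) \<union> R (2 * K + j) = (\<Union>k<Suc K. R (2 * k + j))"
          by (auto simp: lessThan_Suc)
        finally show ?case .
      qed simp
      have "(\<Sum>k<K. \<phi> (R (2 * k + j))) \<le> \<phi> A" for K j
        by (rule order_trans[OF partial \<phi>_mono]) (auto simp: R_def D_def)
      then have half: "(\<Sum>k. \<phi> (R (2 * k + j))) \<le> \<phi> A" for j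
        by (intro suminf_le_const summableI) auto
      have "(\<Sum>k. \<phi> (R k)) = (\<Sum>k. \<phi> (R (2 * k)) + \<phi> (R (2 * k + 1)))"
      proof -
        have "(\<lambda>k. \<phi> (R k)) sums (\<Sum>k. \<phi> (R k))" by (intro summable_sums summableI)
        from sums_group[OF this, of 2]
        have "(\<lambda>k. \<Sum>i\<in>{k * 2..<k * 2 + 2}. \<phi> (R i)) sums (\<Sum>k. \<phi> (R k))" by simp
        moreover have "(\<Sum>i\<in>{k * 2..<k * 2 + 2}. \<phi> (R i)) = \<phi> (R (2 * k)) + \<phi> (R (2 * k + 1))" for k
          by (simp add: numeral_2_eq_2 mult.commute atLeastLessThanSuc)
        ultimately have "(\<lambda>k. \<phi> (R (2 * k)) + \<phi> (R (2 * k + 1))) sums (\<Sum>k. \<phi> (R k))" by simp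
        then show ?thesis
          by (rule sums_unique)
      qed
      also have "\<dots> = (\<Sum>k. \<phi> (R (2 * k + 0))) + (\<Sum>k. \<phi> (R (2 * k + 1)))"
        by (simp add: suminf_add summableI)
      also have "\<dots> \<le> \<phi> A + \<phi> A" by (intro add_mono half)
      also have "\<dots> < \<infinity>" using fin by (simp add: less_top)
      finally have tail: "(\<lambda>k. \<Sum>i. \<phi> (R (i + k))) \<longlonglongrightarrow> 0"
        by (rule tendsto_suminf_tail_ennreal)
      have "\<phi> (A \<inter> F) + \<phi> (A - F) \<le> \<phi> A + (\<Sum>i. \<phi> (R (i + k)))" for k
      proof -
        have "A - F \<subseteq> D k \<union> (\<Union>i. R (i + k))"
        proof
          fix x assume x: "x \<in> A - F"
          then have "infdist x F > 0"
            using \<open>closed F\<close> \<open>F \<noteq> {}\<close> in_closed_iff_infdist_zero[of F x] infdist_nonneg[of x F]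
            by (auto simp: less_le)
          then obtain N where N: "1 / real (Suc N) < infdist x F"
            using nat_approx_posE by blast
          show "x \<in> D k \<union> (\<Union>i. R (i + k))"
          proof (rule ccontr)
            assume neg: "x \<notin> D k \<union> (\<Union>i. R (i + k))"
            have "x \<notin> D (i + k)" for i
              by (induction i) (use neg in \<open>auto simp: R_def\<close>)
            moreover have "x \<in> D (N + k)"
            proof -
              have "1 / real (Suc (N + k)) \<le> 1 / real (Suc N)"
                by (intro divide_left_mono) auto
              then show ?thesis using N x by (auto simp: D_def)
            qed
            ultimately show False by blast
          qed
        qed
        then have "\<phi> (A - F) \<le> \<phi> (D k) + (\<Sum>i. \<phi> (R (i + k)))"
          by (rule order_trans[OF \<phi>_mono order_trans[OF \<phi>_Un add_left_mono[OF \<phi>_UN]]])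
        then have "\<phi> (A \<inter> F) + \<phi> (A - F) \<le> (\<phi> (A \<inter> F) + \<phi> (D k)) + (\<Sum>i. \<phi> (R (i + k)))"
          by (metis add.assoc add_left_mono)
        also have "\<phi> (A \<inter> F) + \<phi> (D k) \<le> \<phi> ((A \<inter> F) \<union> D k)"
        proof (rule sep)
          show "0 < 1 / real (Suc k)" by simp
          fix x y assume "x \<in> A \<inter> F" "y \<in> D k"
          then show "1 / real (Suc k) \<le> dist x y"
            using dist_ge[of y x] by (auto simp: D_def dist_commute)
        qed
        also have "\<phi> ((A \<inter> F) \<union> D k) \<le> \<phi> A" by (rule \<phi>_mono) (auto simp: D_def)
        finally show ?thesis by (simp add: add_right_mono)
      qed
      moreover have "(\<lambda>k. \<phi> A + (\<Sum>i. \<phi> (R (i + k)))) \<longlonglongrightarrow> \<phi> A + 0"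
        by (intro tendsto_add tendsto_const tail)
      ultimately show ?thesis
        by (intro LIMSEQ_le_const[where X="\<lambda>k. \<phi> A + (\<Sum>i. \<phi> (R (i + k)))"]) auto
    qed
    show ?thesis
      unfolding L_def lambda_system_def
    proof (intro CollectI conjI ballI UNIV_I antisym)
      fix A
      show "\<phi> (F \<inter> A) + \<phi> ((UNIV - F) \<inter> A) \<le> \<phi> A"
        using le[of A] by (simp add: Int_commute Diff_eq)
      have "A = (F \<inter> A) \<union> ((UNIV - F) \<inter> A)" by blast
      then show "\<phi> A \<le> \<phi> (F \<inter> A) + \<phi> ((UNIV - F) \<inter> A)" by (metis \<phi>_Un)
    qed
  qed
  have "sigma_algebra UNIV L" using L by (simp add: measure_space_def)
  then have "sets borel \<subseteq> L"
    using closed_L sigma_algebra.sigma_sets_subset[of UNIV L "Collect closed"]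
    by (subst borel_eq_closed) auto
  then show ?thesis
    using L by (rule measure_down[rotated 2]) (rule sets.sigma_algebra_axioms[of borel, simplified])
qed

section \<open>Hausdorff measure\<close>

lemma hausdorff_pre_le:
  assumes "A \<subseteq> (\<Union>i. C i)" "\<And>i. bounded (C i)" "\<And>i. diameter (C i) \<le> \<delta>"
  shows "hausdorff_pre m \<delta> A \<le> (\<Sum>i. hausdorff_weight m (C i))"
  unfolding hausdorff_pre_def by (rule INF_lower) (use assms in auto)

lemma hausdorff_pre_mono:
  assumes "A \<subseteq> B"
  shows "hausdorff_pre m \<delta> A \<le> hausdorff_pre m \<delta> B"
  unfolding hausdorff_pre_def using assms by (intro INF_superset_mono) auto

lemma hausdorff_pre_antimono:
  assumes "\<delta> \<le> \<epsilon>"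
  shows "hausdorff_pre m \<epsilon> A \<le> hausdorff_pre m \<delta> A"
  unfolding hausdorff_pre_def using assms by (intro INF_superset_mono) (auto intro: order_trans)

lemma hausdorff_pre_countably_subadditive:
  fixes A :: "nat \<Rightarrow> 'a::metric_space set"
  shows "hausdorff_pre m \<delta> (\<Union>n. A n) \<le> (\<Sum>n. hausdorff_pre m \<delta> (A n))"
proof (rule ennreal_le_epsilon)
  fix e :: real
  assume e: "0 < e" and fin: "(\<Sum>n. hausdorff_pre m \<delta> (A n)) < top"
  have "\<exists>C. A n \<subseteq> (\<Union>i. C i) \<and> (\<forall>i. bounded (C i) \<and> diameter (C i) \<le> \<delta>)
      \<and> (\<Sum>i. hausdorff_weight m (C i)) < hausdorff_pre m \<delta> (A n) + ennreal (e * (1/2) ^ Suc n)" for n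
    using INF_approx_ennreal[OF _ hausdorff_pre_def, of "e * (1/2) ^ Suc n" m \<delta> "A n"]
      ennreal_suminf_lessD[OF fin, of n] e by (auto simp: less_top)
  then obtain C where C: "\<And>n. A n \<subseteq> (\<Union>i. C n i)" "\<And>n i. bounded (C n i)" "\<And>n i. diameter (C n i) \<le> \<delta>"
    and w: "\<And>n. (\<Sum>i. hausdorff_weight m (C n i)) < hausdorff_pre m \<delta> (A n) + ennreal (e * (1/2) ^ Suc n)"
    by metis
  define D where "D = case_prod C \<circ> prod_decode"
  have "hausdorff_pre m \<delta> (\<Union>n. A n) \<le> (\<Sum>k. hausdorff_weight m (D k))"
  proof (rule hausdorff_pre_le)
    show "(\<Union>n. A n) \<subseteq> (\<Union>k. D k)"
    proof
      fix x assume "x \<in> (\<Union>n. A n)"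
      then obtain n i where "x \<in> C n i" using C(1) by blast
      then have "x \<in> D (prod_encode (n, i))" by (simp add: D_def)
      then show "x \<in> (\<Union>k. D k)" by blast
    qed
  qed (auto simp: D_def C split: prod.split)
  also have "\<dots> = (\<Sum>n. \<Sum>i. hausdorff_weight m (C n i))"
    using suminf_ennreal_2dimen[of "\<lambda>n. \<Sum>i. hausdorff_weight m (C n i)" "\<lambda>p. hausdorff_weight m (case_prod C p)"]
    by (simp add: D_def)
  also have "\<dots> \<le> (\<Sum>n. hausdorff_pre m \<delta> (A n) + ennreal (e * (1/2) ^ Suc n))"
    by (intro suminf_le less_imp_le w) auto
  also have "\<dots> = (\<Sum>n. hausdorff_pre m \<delta> (A n)) + (\<Sum>n. ennreal (e * (1/2) ^ Suc n))"
    by (rule suminf_add[symmetric]) auto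
  also have "(\<Sum>n. ennreal (e * (1/2) ^ Suc n)) = ennreal e"
    using sums_mult[OF power_half_series, of e] e by (intro suminf_ennreal_eq) auto
  finally show "hausdorff_pre m \<delta> (\<Union>n. A n) \<le> (\<Sum>n. hausdorff_pre m \<delta> (A n)) + ennreal e" .
qed

lemma hausdorff_pre_empty:
  assumes "0 \<le> \<delta>"
  shows "hausdorff_pre m \<delta> {} = 0"
  using hausdorff_pre_le[of "{}" "\<lambda>_. {}" \<delta> m] assms by (simp add: hausdorff_weight_def)

text \<open>
  A covering set of diameter at most \<open>\<delta>\<close> cannot meet both \<open>A\<close> and \<open>B\<close>, so every cover of the union
  splits into a cover of \<open>A\<close> and a cover of \<open>B\<close> that share no member.
\<close>

lemma hausdorff_pre_add_le_if_separated:
  fixes A B :: "'a::metric_space set"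
  assumes sep: "\<And>x y. x \<in> A \<Longrightarrow> y \<in> B \<Longrightarrow> \<delta> < dist x y" and "0 \<le> \<delta>"
  shows "hausdorff_pre m \<delta> A + hausdorff_pre m \<delta> B \<le> hausdorff_pre m \<delta> (A \<union> B)"
  unfolding hausdorff_pre_def[of m \<delta> "A \<union> B"]
proof (rule INF_greatest)
  fix C :: "nat \<Rightarrow> 'a set"
  assume "C \<in> {C. A \<union> B \<subseteq> (\<Union>i. C i) \<and> (\<forall>i. bounded (C i) \<and> diameter (C i) \<le> \<delta>)}"
  then have C: "A \<union> B \<subseteq> (\<Union>i. C i)" "\<And>i. bounded (C i)" "\<And>i. diameter (C i) \<le> \<delta>" by auto
  define CA where "CA i = (if C i \<inter> A = {} then {} else C i)" for i
  define CB where "CB i = (if C i \<inter> B = {} then {} else C i)" for i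
  have "hausdorff_pre m \<delta> A + hausdorff_pre m \<delta> B
      \<le> (\<Sum>i. hausdorff_weight m (CA i)) + (\<Sum>i. hausdorff_weight m (CB i))"
  proof (intro add_mono hausdorff_pre_le)
    show "A \<subseteq> (\<Union>i. CA i)" "B \<subseteq> (\<Union>i. CB i)" using C(1) by (fastforce simp: CA_def CB_def)+
  qed (use C \<open>0 \<le> \<delta>\<close> in \<open>auto simp: CA_def CB_def\<close>)
  also have "\<dots> = (\<Sum>i. hausdorff_weight m (CA i) + hausdorff_weight m (CB i))"
    by (rule suminf_add) auto
  also have "\<dots> \<le> (\<Sum>i. hausdorff_weight m (C i))"
  proof (intro suminf_le)
    fix i
    have "C i \<inter> A = {} \<or> C i \<inter> B = {}"
    proof (rule ccontr)
      assume "\<not> (C i \<inter> A = {} \<or> C i \<inter> B = {})"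
      then obtain x y where "x \<in> C i" "x \<in> A" "y \<in> C i" "y \<in> B" by blast
      then show False
        using sep[of x y] diameter_bounded_bound[OF C(2), of x i y] C(3)[of i] by simp
    qed
    then show "hausdorff_weight m (CA i) + hausdorff_weight m (CB i) \<le> hausdorff_weight m (C i)"
      by (auto simp: CA_def CB_def hausdorff_weight_def)
  qed auto
  finally show "hausdorff_pre m \<delta> A + hausdorff_pre m \<delta> B \<le> (\<Sum>i. hausdorff_weight m (C i))" .
qed

lemma hausdorff_pre_le_outer: "0 < \<delta> \<Longrightarrow> hausdorff_pre m \<delta> A \<le> hausdorff_outer m A"
  unfolding hausdorff_outer_def by (rule SUP_upper) simp

lemma hausdorff_outer_add_le_if_separated:
  fixes A B :: "'a::metric_space set"
  assumes "0 < e" and sep: "\<And>x y. x \<in> A \<Longrightarrow> y \<in> B \<Longrightarrow> e \<le> dist x y"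
  shows "hausdorff_outer m A + hausdorff_outer m B \<le> hausdorff_outer m (A \<union> B)"
proof -
  have "hausdorff_outer m A + hausdorff_outer m B
      = (SUP \<delta>\<in>{0<..}. hausdorff_pre m \<delta> A + hausdorff_pre m \<delta> B)"
    unfolding hausdorff_outer_def
  proof (rule SUP_add_directed_ennreal[symmetric])
    fix i j :: real assume "i \<in> {0<..}" "j \<in> {0<..}"
    then show "\<exists>k\<in>{0<..}. hausdorff_pre m i A + hausdorff_pre m j B
        \<le> hausdorff_pre m k A + hausdorff_pre m k B"
      by (intro bexI[of _ "min i j"] add_mono hausdorff_pre_antimono) auto
  qed
  also have "\<dots> \<le> hausdorff_outer m (A \<union> B)"
  proof (rule SUP_least)
    fix \<delta> :: real assume "\<delta> \<in> {0<..}"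
    \<comment> \<open>The mesh is also taken below \<open>e\<close>, so that no covering set meets both parts.\<close>
    define \<eta> where "\<eta> = min \<delta> (e / 2)"
    have \<eta>: "0 < \<eta>" "\<eta> \<le> \<delta>" "\<eta> < e" using \<open>0 < e\<close> \<open>\<delta> \<in> {0<..}\<close> by (auto simp: \<eta>_def)
    have "hausdorff_pre m \<delta> A + hausdorff_pre m \<delta> B \<le> hausdorff_pre m \<eta> A + hausdorff_pre m \<eta> B"
      by (intro add_mono hausdorff_pre_antimono \<eta>)
    also have "\<dots> \<le> hausdorff_pre m \<eta> (A \<union> B)"
      using \<eta> sep by (intro hausdorff_pre_add_le_if_separated) fastforce+
    also have "\<dots> \<le> hausdorff_outer m (A \<union> B)" by (rule hausdorff_pre_le_outer) fact
    finally show "hausdorff_pre m \<delta> A + hausdorff_pre m \<delta> B \<le> hausdorff_outer m (A \<union> B)" .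
  qed
  finally show ?thesis .
qed

text \<open>
  This is what makes \<^const>\<open>hausdorff_measure\<close> meaningful: \<^const>\<open>measure_of\<close> yields the zero measure when
  the given set function is not countably additive.
\<close>

proposition measure_space_hausdorff_outer:
  "measure_space UNIV (sets borel) (hausdorff_outer m :: 'a::metric_space set \<Rightarrow> ennreal)"
proof (rule metric_outer_measure_imp_measure_space_borel)
  show "hausdorff_outer m ({} :: 'a set) = 0"
    unfolding hausdorff_outer_def by (intro antisym SUP_least) (auto simp: hausdorff_pre_empty)
  show "hausdorff_outer m A \<le> hausdorff_outer m B" if "A \<subseteq> B" for A B :: "'a set"
    unfolding hausdorff_outer_def by (intro SUP_mono) (use hausdorff_pre_mono[OF that] in auto)
  show "hausdorff_outer m (\<Union>i. A i) \<le> (\<Sum>i. hausdorff_outer m (A i))" for A :: "nat \<Rightarrow> 'a set"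
    unfolding hausdorff_outer_def[of m "\<Union>i. A i"]
  proof (rule SUP_least)
    fix \<delta> :: real assume "\<delta> \<in> {0<..}"
    then show "hausdorff_pre m \<delta> (\<Union>i. A i) \<le> (\<Sum>i. hausdorff_outer m (A i))"
      by (intro order_trans[OF hausdorff_pre_countably_subadditive] suminf_le hausdorff_pre_le_outer) auto
  qed
qed (rule hausdorff_outer_add_le_if_separated)

lemma sets_hausdorff_measure [measurable_cong, simp]:
  "sets (hausdorff_measure m :: 'a::metric_space measure) = sets borel"
  unfolding hausdorff_measure_def using sets.sigma_sets_eq[of "borel :: 'a measure"] by simp

lemma space_hausdorff_measure [simp]: "space (hausdorff_measure m) = UNIV"
  unfolding hausdorff_measure_def by simp

lemma emeasure_hausdorff_measure:
  assumes "A \<in> sets borel"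
  shows "emeasure (hausdorff_measure m) A = hausdorff_outer m A"
  using emeasure_measure_of_sigma[of UNIV "sets borel" "hausdorff_outer m" A]
    measure_space_hausdorff_outer[where 'a='a] assms
  by (auto simp: hausdorff_measure_def measure_space_def)

lemma diameter_isometric_image:
  fixes T :: "'a::metric_space \<Rightarrow> 'b::metric_space"
  assumes "\<And>x y. dist (T x) (T y) = dist x y"
  shows "diameter (T ` C) = diameter C"
proof -
  have "T ` C \<times> T ` C = map_prod T T ` (C \<times> C)" by auto
  then have "(\<lambda>(x, y). dist x y) ` (T ` C \<times> T ` C) = (\<lambda>(x, y). dist x y) ` (C \<times> C)"
    by (simp add: image_image assms split_def)
  then show ?thesis by (simp add: diameter_def)
qed

lemma hausdorff_outer_isometric_image_le:
  fixes T :: "'a::metric_space \<Rightarrow> 'b::metric_space"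
  assumes T: "\<And>x y. dist (T x) (T y) = dist x y"
  shows "hausdorff_outer m (T ` A) \<le> hausdorff_outer m A"
  unfolding hausdorff_outer_def
proof (rule SUP_mono, rule bexI)
  fix \<delta> :: real
  show "hausdorff_pre m \<delta> (T ` A) \<le> hausdorff_pre m \<delta> A"
    unfolding hausdorff_pre_def[of m \<delta> A]
  proof (rule INF_greatest)
    fix C :: "nat \<Rightarrow> 'a set"
    assume C: "C \<in> {C. A \<subseteq> (\<Union>i. C i) \<and> (\<forall>i. bounded (C i) \<and> diameter (C i) \<le> \<delta>)}"
    have "hausdorff_pre m \<delta> (T ` A) \<le> (\<Sum>i. hausdorff_weight m (T ` C i))"
    proof (rule hausdorff_pre_le)
      show "bounded (T ` C i)" for i
      proof -
        obtain x e where "\<forall>y\<in>C i. dist x y \<le> e" using C unfolding bounded_def by blast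
        then show ?thesis unfolding bounded_def by (intro exI[of _ "T x"] exI[of _ e]) (auto simp: T)
      qed
      show "T ` A \<subseteq> (\<Union>i. T ` C i)" using C by blast
    qed (use C in \<open>auto simp: diameter_isometric_image T\<close>)
    moreover have "hausdorff_weight m (T ` C i) = hausdorff_weight m (C i)" for i
      by (cases "C i = {}") (simp_all add: hausdorff_weight_def diameter_isometric_image[of T, OF T])
    ultimately show "hausdorff_pre m \<delta> (T ` A) \<le> (\<Sum>i. hausdorff_weight m (C i))"
      by simp
  qed
qed

section \<open>Bounds for the Hausdorff measure of the sphere\<close>

text \<open>
  A covering set that meets \<open>S\<close> lies in a ball centred in \<open>S\<close> whose radius is its diameter, so
  its weight is at least a fixed multiple of the mass that \<open>M\<close> gives it.
\<close>

lemma mass_distribution_principle: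
  fixes M :: "'a::metric_space measure"
  assumes sets: "sets M = sets borel" and S: "AE x in M. x \<in> S"
    and "0 < K" and cball: "\<And>p e. p \<in> S \<Longrightarrow> 0 \<le> e \<Longrightarrow> emeasure M (cball p e) \<le> ennreal (K * e ^ m)"
  shows "emeasure M UNIV / ennreal (K * 2 ^ m / unit_ball_vol (real m)) \<le> hausdorff_pre m \<delta> S"
  unfolding hausdorff_pre_def
proof (rule INF_greatest)
  define c where "c = K * 2 ^ m / unit_ball_vol (real m)"
  have "c > 0" using \<open>0 < K\<close> by (simp add: c_def)
  fix C :: "nat \<Rightarrow> 'a set"
  assume "C \<in> {C. S \<subseteq> (\<Union>i. C i) \<and> (\<forall>i. bounded (C i) \<and> diameter (C i) \<le> \<delta>)}"
  then have C: "S \<subseteq> (\<Union>i. C i)" "\<And>i. bounded (C i)" by auto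
  have "\<exists>D. closed D \<and> C i \<inter> S \<subseteq> D \<and> emeasure M D \<le> ennreal c * hausdorff_weight m (C i)" for i
  proof (cases "C i \<inter> S = {}")
    case True
    then show ?thesis by (intro exI[of _ "{}"]) auto
  next
    case False
    then obtain p where p: "p \<in> C i" "p \<in> S" by blast
    have "emeasure M (cball p (diameter (C i))) \<le> ennreal (K * diameter (C i) ^ m)"
      using p C diameter_ge_0 by (intro cball) auto
    also have "K * diameter (C i) ^ m = c * (unit_ball_vol (real m) * (diameter (C i) / 2) ^ m)"
      using unit_ball_vol_pos[of "real m", THEN less_imp_neq] by (simp add: c_def field_simps)
    also have "ennreal \<dots> = ennreal c * hausdorff_weight m (C i)"
      using p \<open>c > 0\<close> by (subst ennreal_mult') (auto simp: hausdorff_weight_def)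
    finally show ?thesis
      using p C(2)[of i] diameter_bounded_bound[of "C i" p] by (intro exI[of _ "cball p (diameter (C i))"]) auto
  qed
  then obtain D where D: "\<And>i. closed (D i)" "\<And>i. C i \<inter> S \<subseteq> D i"
    "\<And>i. emeasure M (D i) \<le> ennreal c * hausdorff_weight m (C i)" by metis
  have [measurable]: "D i \<in> sets M" for i using D(1) by (simp add: sets)
  have "emeasure M UNIV \<le> emeasure M (\<Union>i. D i)"
  proof (rule emeasure_mono_AE)
    show "AE x in M. x \<in> UNIV \<longrightarrow> x \<in> (\<Union>i. D i)"
      using S by eventually_elim (use C(1) D(2) in blast)
  qed measurable
  also have "\<dots> \<le> (\<Sum>i. emeasure M (D i))"
    by (intro emeasure_subadditive_countably) auto
  also have "\<dots> \<le> (\<Sum>i. ennreal c * hausdorff_weight m (C i))"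
    by (intro suminf_le D) auto
  also have "\<dots> = ennreal c * (\<Sum>i. hausdorff_weight m (C i))" by simp
  finally show "emeasure M UNIV / ennreal (K * 2 ^ m / unit_ball_vol (real m)) \<le> (\<Sum>i. hausdorff_weight m (C i))"
    unfolding c_def[symmetric] using \<open>c > 0\<close> by (intro divide_le_posI_ennreal) (auto simp: mult.commute)
qed

lemma hausdorff_pre_le_finite_cballs:
  fixes S :: "'a::euclidean_space set"
  assumes "finite F" "S \<subseteq> (\<Union>p\<in>F. cball p e)" "0 \<le> e"
  shows "hausdorff_pre m (2 * e) S \<le> ennreal (real (card F) * (unit_ball_vol (real m) * e ^ m))"
proof -
  obtain h where h: "bij_betw h {..<card F} F"
    using bij_betw_from_nat_into_finite[OF \<open>finite F\<close>] by blast
  define C where "C i = (if i < card F then cball (h i) e else {})" for i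
  have "hausdorff_pre m (2 * e) S \<le> (\<Sum>i. hausdorff_weight m (C i))"
  proof (rule hausdorff_pre_le)
    have F_sub: "F \<subseteq> h ` {..<card F}" using h by (simp add: bij_betw_def)
    show "S \<subseteq> (\<Union>i. C i)"
    proof
      fix x assume "x \<in> S"
      then obtain p where p: "p \<in> F" "x \<in> cball p e" using assms(2) by blast
      then obtain i where "i < card F" "p = h i" using F_sub by blast
      with p have "i < card F" "x \<in> cball (h i) e" by auto
      then have "x \<in> C i" by (simp add: C_def)
      then show "x \<in> (\<Union>i. C i)" by blast
    qed
  qed (use \<open>0 \<le> e\<close> in \<open>auto simp: C_def\<close>)
  also have "\<dots> = (\<Sum>i<card F. hausdorff_weight m (C i))"
    by (rule suminf_finite) (auto simp: C_def hausdorff_weight_def)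
  also have "\<dots> = (\<Sum>i<card F. ennreal (unit_ball_vol (real m) * e ^ m))"
    using \<open>0 \<le> e\<close> by (intro sum.cong) (auto simp: C_def hausdorff_weight_def)
  also have "\<dots> = ennreal (real (card F) * (unit_ball_vol (real m) * e ^ m))"
    using \<open>0 \<le> e\<close> by (simp add: ennreal_mult ennreal_of_nat_eq_real_of_nat)
  finally show ?thesis .
qed

lemma annulus_power_diff_le:
  fixes t :: real
  assumes "0 \<le> t" "t \<le> 1"
  shows "(1 + t) ^ k - (1 - t) ^ k \<le> real k * 2 ^ k * t"
proof (induction k)
  case (Suc k)
  have "(1 + t) ^ Suc k - (1 - t) ^ Suc k = (1 + t) * ((1 + t) ^ k - (1 - t) ^ k) + 2 * t * (1 - t) ^ k"
    by (simp add: algebra_simps)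
  also have "\<dots> \<le> 2 * (real k * 2 ^ k * t) + 2 * t * 2 ^ k"
  proof (intro add_mono mult_mono Suc mult_left_mono)
    show "0 \<le> (1 + t) ^ k - (1 - t) ^ k" using assms by (simp add: power_mono)
    have "(1 - t) ^ k \<le> 1" using assms by (intro power_le_one) auto
    then show "(1 - t) ^ k \<le> 2 ^ k" using one_le_power[of "2::real" k] by linarith
  qed (use assms in auto)
  also have "\<dots> = real (Suc k) * 2 ^ Suc k * t" by (simp add: algebra_simps)
  finally show ?case .
qed simp

text \<open>
  The balls of radius \<open>e / 2\<close> around the points are disjoint and lie in an annulus of thickness \<open>e\<close>,
  whose volume is of order \<open>e\<close>, while each ball has volume of order \<open>e\<^sup>n\<close>.
\<close>

lemma card_separated_sphere_le:
  fixes F :: "'a::euclidean_space set"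
  assumes F: "F \<subseteq> sphere 0 1" "finite F" and sep: "\<And>x y. x \<in> F \<Longrightarrow> y \<in> F \<Longrightarrow> x \<noteq> y \<Longrightarrow> e \<le> dist x y"
    and e: "0 < e" "e \<le> 1"
  shows "real (card F) * (e / 2) ^ (DIM('a) - 1) \<le> real DIM('a) * 2 ^ DIM('a)"
proof -
  define t n \<omega> where "t = e / 2" and "n = DIM('a)" and "\<omega> = unit_ball_vol (real n)"
  have t: "0 < t" "t \<le> 1" using e by (auto simp: t_def)
  have \<omega>: "0 < \<omega>" by (simp add: \<omega>_def)
  have "n > 0" by (simp add: n_def)
  have disj: "disjoint_family_on (\<lambda>x. ball x t) F"
    unfolding disjoint_family_on_def
  proof (intro ballI impI)
    fix x y assume "x \<in> F" "y \<in> F" "x \<noteq> y"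
    from sep[OF this] show "ball x t \<inter> ball y t = {}"
      by (intro disjoint_ballI) (simp add: t_def)
  qed
  have "ennreal (real (card F) * (\<omega> * t ^ n)) = (\<Sum>x\<in>F. emeasure lborel (ball x t))"
    using t \<omega> by (simp add: emeasure_ball ennreal_mult ennreal_of_nat_eq_real_of_nat n_def \<omega>_def)
  also have "\<dots> = emeasure lborel (\<Union>x\<in>F. ball x t)"
    using F disj by (intro sum_emeasure) auto
  also have "\<dots> \<le> emeasure lborel (ball 0 (1 + t) - ball (0::'a) (1 - t))"
  proof (rule emeasure_mono)
    show "(\<Union>x\<in>F. ball x t) \<subseteq> ball 0 (1 + t) - ball (0::'a) (1 - t)"
    proof safe
      fix x y assume "x \<in> F" "y \<in> ball x t"
      then have *: "norm x = 1" "norm (x - y) < t" using F by (auto simp: dist_norm)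
      have "norm y \<le> norm x + norm (x - y)" "norm x \<le> norm y + norm (x - y)"
        by (metis norm_triangle_sub norm_minus_commute, metis norm_triangle_sub)
      with * show "y \<in> ball 0 (1 + t)" "y \<in> ball 0 (1 - t) \<Longrightarrow> False" by auto
    qed
  qed auto
  also have "\<dots> = emeasure lborel (ball (0::'a) (1 + t)) - emeasure lborel (ball (0::'a) (1 - t))"
    using t emeasure_lborel_ball_finite[of "0::'a" "1 - t"]
    by (intro emeasure_Diff) (auto simp: less_top[symmetric] intro: subset_ball)
  also have "\<dots> = ennreal (\<omega> * ((1 + t) ^ n - (1 - t) ^ n))"
    using t \<omega> by (simp add: emeasure_ball n_def \<omega>_def ennreal_minus[symmetric] right_diff_distrib)
  finally have "real (card F) * (\<omega> * t ^ n) \<le> \<omega> * ((1 + t) ^ n - (1 - t) ^ n)"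
    using t \<omega> by (subst (asm) ennreal_le_iff) (auto intro!: mult_nonneg_nonneg power_mono)
  also have "\<dots> \<le> \<omega> * (real n * 2 ^ n * t)"
    using t \<omega> by (intro mult_left_mono annulus_power_diff_le) auto
  finally have "(real (card F) * t ^ (n - 1)) * (\<omega> * t) \<le> (real n * 2 ^ n) * (\<omega> * t)"
    using \<open>n > 0\<close> by (cases n) (simp_all add: mult_ac)
  then show ?thesis
    using t \<omega> by (simp add: t_def n_def)
qed

text \<open>
  A separated subset of the sphere of maximal cardinality is a net, so its packing bound is also
  a covering bound.
\<close>

lemma hausdorff_outer_sphere_finite:
  "hausdorff_outer (DIM('a) - 1) (sphere (0::'a::euclidean_space) 1) < \<infinity>"
proof -
  define m where "m = DIM('a) - 1"
  define B where "B = real DIM('a) * 2 ^ DIM('a)"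
  have "hausdorff_pre m \<delta> (sphere (0::'a) 1) \<le> ennreal (B * (unit_ball_vol (real m) * 2 ^ m))" if "0 < \<delta>" for \<delta>
  proof -
    define e where "e = min 1 (\<delta> / 2)"
    have e: "0 < e" "e \<le> 1" "2 * e \<le> \<delta>" using that by (auto simp: e_def)
    define P where "P F \<longleftrightarrow> F \<subseteq> sphere (0::'a) 1 \<and> finite F \<and>
      (\<forall>x\<in>F. \<forall>y\<in>F. x \<noteq> y \<longrightarrow> e \<le> dist x y)" for F
    have bound: "real (card F) * (e / 2) ^ m \<le> B" if "P F" for F
      unfolding m_def B_def using that e by (intro card_separated_sphere_le) (auto simp: P_def)
    have "\<exists>F. P F \<and> (\<forall>G. P G \<longrightarrow> card G \<le> card F)"
    proof (rule ex_has_greatest_nat)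
      show "P {}" by (simp add: P_def)
      show "\<forall>G. P G \<longrightarrow> card G < Suc (nat \<lceil>B / (e / 2) ^ m\<rceil>)"
      proof (intro allI impI)
        fix G assume "P G"
        then have "real (card G) \<le> B / (e / 2) ^ m"
          using bound e by (simp add: pos_le_divide_eq)
        also have "\<dots> \<le> real (nat \<lceil>B / (e / 2) ^ m\<rceil>)" by (rule real_nat_ceiling_ge)
        finally show "card G < Suc (nat \<lceil>B / (e / 2) ^ m\<rceil>)" by simp
      qed
    qed
    then obtain F where F: "P F" and max: "\<And>G. P G \<Longrightarrow> card G \<le> card F" by blast
    have cover: "sphere (0::'a) 1 \<subseteq> (\<Union>p\<in>F. cball p e)"
    proof (rule ccontr)
      assume "\<not> sphere (0::'a) 1 \<subseteq> (\<Union>p\<in>F. cball p e)"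
      then obtain x where x: "x \<in> sphere 0 1" "\<And>p. p \<in> F \<Longrightarrow> e < dist p x" by force
      then have "P (insert x F)" using F by (fastforce simp: P_def dist_commute)
      moreover have "x \<notin> F" using x(2)[of x] e by auto
      ultimately show False using max[of "insert x F"] F by (auto simp: P_def)
    qed
    have "hausdorff_pre m \<delta> (sphere (0::'a) 1) \<le> hausdorff_pre m (2 * e) (sphere (0::'a) 1)"
      by (rule hausdorff_pre_antimono) fact
    also have "\<dots> \<le> ennreal (real (card F) * (unit_ball_vol (real m) * e ^ m))"
      using F cover e by (intro hausdorff_pre_le_finite_cballs) (auto simp: P_def)
    also have "real (card F) * (unit_ball_vol (real m) * e ^ m)
        = (real (card F) * (e / 2) ^ m) * (unit_ball_vol (real m) * 2 ^ m)"
      by (simp add: power_divide)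
    also have "ennreal \<dots> \<le> ennreal (B * (unit_ball_vol (real m) * 2 ^ m))"
      using bound[OF F] by (intro ennreal_leI mult_right_mono) auto
    finally show ?thesis .
  qed
  then have "hausdorff_outer m (sphere (0::'a) 1) \<le> ennreal (B * (unit_ball_vol (real m) * 2 ^ m))"
    unfolding hausdorff_outer_def by (intro SUP_least) auto
  also have "\<dots> < \<infinity>" by simp
  finally show ?thesis by (simp add: m_def)
qed

section \<open>The cone measure\<close>

text \<open>
  Supported on the unit sphere; the origin, where \<^const>\<open>sgn\<close> vanishes, is a null set.
\<close>

definition cone_measure :: "'a::euclidean_space measure" where
  "cone_measure = distr (density lborel (indicator (ball 0 1))) borel sgn"

lemma sets_cone_measure [measurable_cong, simp]: "sets cone_measure = sets borel"
  by (simp add: cone_measure_def)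

lemma space_cone_measure [simp]: "space cone_measure = UNIV"
  by (simp add: cone_measure_def)

lemma nn_integral_cone_measure:
  fixes g :: "'a::euclidean_space \<Rightarrow> ennreal"
  assumes [measurable]: "g \<in> borel_measurable borel"
  shows "(\<integral>\<^sup>+x. g x \<partial>cone_measure) = (\<integral>\<^sup>+x. indicator (ball 0 1) x * g (sgn x) \<partial>lborel)"
  unfolding cone_measure_def
  by (subst nn_integral_distr) (auto simp: borel_measurable_indicator intro!: nn_integral_density)

lemma emeasure_cone_measure:
  fixes A :: "'a::euclidean_space set"
  assumes [measurable]: "A \<in> sets borel"
  shows "emeasure cone_measure A = emeasure lborel {x \<in> ball 0 1. sgn x \<in> A}"
proof -
  have "emeasure cone_measure A = (\<integral>\<^sup>+x. indicator (ball 0 1) x * indicator A (sgn x) \<partial>lborel)"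
    using nn_integral_cone_measure[of "indicator A"] by simp
  also have "\<dots> = (\<integral>\<^sup>+x. indicator {x \<in> ball 0 1. sgn x \<in> A} x \<partial>lborel)"
    by (intro nn_integral_cong) (simp add: indicator_def)
  also have "\<dots> = emeasure lborel {x \<in> ball 0 1. sgn x \<in> A}"
    by (intro nn_integral_indicator) simp
  finally show ?thesis .
qed

lemma emeasure_cone_measure_UNIV:
  "emeasure (cone_measure :: 'a::euclidean_space measure) UNIV = ennreal (unit_ball_vol (real DIM('a)))"
proof -
  have "emeasure (cone_measure :: 'a measure) UNIV = emeasure lborel (ball (0::'a) 1)"
    by (subst emeasure_cone_measure) (auto intro!: arg_cong[where f="emeasure lborel"])
  then show ?thesis by (simp add: emeasure_ball)
qed

lemma AE_cone_measure_sphere: "AE x in (cone_measure :: 'a::euclidean_space measure). x \<in> sphere 0 1"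
proof -
  have "AE x in lborel. x \<noteq> (0::'a)" by (rule AE_lborel_singleton)
  then have "AE x in density lborel (indicator (ball 0 1)). sgn x \<in> sphere (0::'a) 1"
    by (subst AE_density) (auto simp: norm_sgn borel_measurable_indicator elim!: eventually_mono)
  then show ?thesis
    unfolding cone_measure_def by (subst AE_distr_iff) auto
qed

lemma sgn_orthogonal_transformation:
  "orthogonal_transformation T \<Longrightarrow> sgn (T x) = T (sgn x)"
  by (simp add: sgn_div_norm orthogonal_transformation_norm orthogonal_transformation_scaleR)

lemma cone_measure_ball_orthogonal:
  fixes T :: "'a::euclidean_space \<Rightarrow> 'a"
  assumes T: "orthogonal_transformation T"
  shows "emeasure cone_measure (ball (T u) r) = emeasure cone_measure (ball u r)"
proof -
  have [measurable]: "T \<in> borel_measurable borel"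
    using T by (intro borel_measurable_continuous_onI linear_continuous_on
        linear_conv_bounded_linear[THEN iffD1] orthogonal_transformation_linear)
  have "emeasure cone_measure (ball (T u) r)
      = emeasure (distr lborel borel T) {x \<in> ball 0 1. sgn x \<in> ball (T u) r}"
    by (simp add: emeasure_cone_measure distr_lborel_orthogonal[OF T])
  also have "\<dots> = emeasure lborel (T -` {x \<in> ball 0 1. sgn x \<in> ball (T u) r})"
    by (subst emeasure_distr) auto
  also have "T -` {x \<in> ball 0 1. sgn x \<in> ball (T u) r} = {x \<in> ball 0 1. sgn x \<in> ball u r}"
    using T by (auto simp: sgn_orthogonal_transformation orthogonal_transformation_norm
        orthogonal_transformation_isometry)
  finally show ?thesis by (simp add: emeasure_cone_measure)
qed

text \<open>
  For \<open>e \<le> 1\<close>, the cone over a cap of radius \<open>e\<close> lies in a tube of radius \<open>e\<close> around the segment from the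
  origin to \<open>p\<close>, and the tube is covered by about \<open>1 / e\<close> balls of radius \<open>2 e\<close> with centres along the segment.
\<close>

lemma cone_measure_cball_le_pos:
  fixes p :: "'a::euclidean_space"
  assumes p: "p \<in> sphere 0 1" and e: "0 < e"
  shows "emeasure cone_measure (cball p e)
    \<le> ennreal (2 ^ (DIM('a) + 1) * unit_ball_vol (real DIM('a)) * e ^ (DIM('a) - 1))"
proof -
  define n \<omega> where "n = DIM('a)" and "\<omega> = unit_ball_vol (real n)"
  have \<omega>: "0 < \<omega>" by (simp add: \<omega>_def)
  have "n > 0" by (simp add: n_def)
  show ?thesis
  proof (cases "e \<le> 1")
    case True
    define N where "N = nat \<lceil>1 / e\<rceil>"
    have N: "real N \<le> 2 / e"
    proof -
      have "real N < 1 / e + 1" unfolding N_def using e using ceiling_correct[of "1 / e"] by simp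
      moreover have "1 \<le> 1 / e" using e True by simp
      ultimately show ?thesis by (simp add: field_simps)
    qed
    have "{x \<in> ball 0 1. sgn x \<in> cball p e} \<subseteq> (\<Union>j<N. cball ((real j * e) *\<^sub>R p) (2 * e))"
    proof safe
      fix x :: 'a assume x: "x \<in> ball 0 1" "sgn x \<in> cball p e"
      \<comment> \<open>The centre that lies less than \<open>e\<close> below the height of \<open>x\<close> in the tube.\<close>
      define j where "j = nat \<lfloor>norm x / e\<rfloor>"
      have j: "real j = of_int \<lfloor>norm x / e\<rfloor>" using e by (simp add: j_def)
      have "real j \<le> norm x / e" "norm x / e < real j + 1" unfolding j by linarith+
      then have j_bounds: "real j * e \<le> norm x" "norm x < (real j + 1) * e"
        using e by (simp_all add: field_simps)
      have "norm x / e < 1 / e" using x e by (simp add: divide_strict_right_mono)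
      then have "real j < real N"
        using \<open>real j \<le> norm x / e\<close> real_nat_ceiling_ge[of "1 / e"] unfolding N_def by linarith
      moreover have "dist ((real j * e) *\<^sub>R p) x \<le> 2 * e"
      proof -
        have "norm x *\<^sub>R sgn x = x" by (cases "x = 0") (simp_all add: sgn_div_norm)
        then have "(real j * e) *\<^sub>R p - x = norm x *\<^sub>R (p - sgn x) - (norm x - real j * e) *\<^sub>R p"
          by (simp add: scaleR_right_diff_distrib scaleR_left_diff_distrib)
        then have "dist ((real j * e) *\<^sub>R p) x \<le> norm x * norm (p - sgn x) + \<bar>norm x - real j * e\<bar> * norm p"
          using norm_triangle_ineq4[of "norm x *\<^sub>R (p - sgn x)" "(norm x - real j * e) *\<^sub>R p"]
          by (simp add: dist_norm)
        also have "\<dots> \<le> 1 * e + e * 1"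
          using x p e j_bounds by (intro add_mono mult_mono) (auto simp: dist_norm algebra_simps)
        finally show ?thesis by simp
      qed
      ultimately show "x \<in> (\<Union>j<N. cball ((real j * e) *\<^sub>R p) (2 * e))" by auto
    qed
    then have "emeasure cone_measure (cball p e)
        \<le> emeasure lborel (\<Union>j<N. cball ((real j * e) *\<^sub>R p) (2 * e))"
      by (subst emeasure_cone_measure) (auto intro!: emeasure_mono)
    also have "\<dots> \<le> (\<Sum>j<N. emeasure lborel (cball ((real j * e) *\<^sub>R p) (2 * e)))"
      by (intro emeasure_subadditive_finite) auto
    also have "\<dots> = ennreal (real N * (\<omega> * (2 * e) ^ n))"
      using e \<omega> by (simp add: emeasure_cball ennreal_mult ennreal_of_nat_eq_real_of_nat n_def \<omega>_def)
    also have "\<dots> \<le> ennreal (2 / e * (\<omega> * (2 * e) ^ n))"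
      using N e \<omega> by (intro ennreal_leI mult_right_mono) auto
    also have "2 / e * (\<omega> * (2 * e) ^ n) = 2 ^ (n + 1) * \<omega> * e ^ (n - 1)"
      using e \<open>n > 0\<close> by (cases n) (simp_all add: power_mult_distrib)
    finally show ?thesis by (simp add: n_def \<omega>_def)
  next
    case False
    have "emeasure cone_measure (cball p e) \<le> emeasure (cone_measure :: 'a measure) UNIV"
      by (intro emeasure_mono) auto
    also have "\<dots> = ennreal (1 * \<omega> * 1)" by (simp add: emeasure_cone_measure_UNIV n_def \<omega>_def)
    also have "\<dots> \<le> ennreal (2 ^ (n + 1) * \<omega> * e ^ (n - 1))"
      using False \<omega> by (intro ennreal_leI mult_mono one_le_power) auto
    finally show ?thesis by (simp add: n_def \<omega>_def)
  qed
qed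

text \<open>
  Radius zero is needed because covering sets may be single points; it follows by
  letting the radius decrease.  In dimension one this reads \<open>0\<^sup>0 = 1\<close>, in accordance with the
  Hausdorff weight of a point.
\<close>

lemma cone_measure_cball_le:
  fixes p :: "'a::euclidean_space"
  assumes p: "p \<in> sphere 0 1" and e: "0 \<le> e"
  shows "emeasure cone_measure (cball p e)
    \<le> ennreal (2 ^ (DIM('a) + 1) * unit_ball_vol (real DIM('a)) * e ^ (DIM('a) - 1))"
proof -
  define K where "K = 2 ^ (DIM('a) + 1) * unit_ball_vol (real DIM('a))"
  define d where "d k = e + inverse (real (Suc k))" for k
  have d: "d k > e" for k by (simp add: d_def)
  have "(\<lambda>k. ennreal (K * d k ^ (DIM('a) - 1))) \<longlonglongrightarrow> ennreal (K * e ^ (DIM('a) - 1))"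
    using tendsto_add[OF tendsto_const LIMSEQ_inverse_real_of_nat, of e] unfolding d_def
    by (intro tendsto_intros) simp_all
  moreover have "emeasure cone_measure (cball p e) \<le> ennreal (K * d k ^ (DIM('a) - 1))" for k
  proof -
    have "emeasure cone_measure (cball p e) \<le> emeasure cone_measure (cball p (d k))"
      using d[of k] by (intro emeasure_mono) auto
    also have "\<dots> \<le> ennreal (K * d k ^ (DIM('a) - 1))"
      unfolding K_def using d[of k] e by (intro cone_measure_cball_le_pos p) auto
    finally show ?thesis .
  qed
  ultimately show ?thesis
    unfolding K_def by (intro LIMSEQ_le_const) auto
qed

lemma hausdorff_outer_sphere_pos:
  "0 < hausdorff_outer (DIM('a) - 1) (sphere (0::'a::euclidean_space) 1)"
proof -
  define K m where "K = 2 ^ (DIM('a) + 1) * unit_ball_vol (real DIM('a))" and "m = DIM('a) - 1"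
  have K: "0 < K" by (simp add: K_def)
  have "0 < emeasure (cone_measure :: 'a measure) UNIV / ennreal (K * 2 ^ m / unit_ball_vol (real m))"
    using K by (simp add: emeasure_cone_measure_UNIV divide_ennreal)
  also have "\<dots> \<le> hausdorff_pre m 1 (sphere (0::'a) 1)"
    by (rule mass_distribution_principle[OF _ AE_cone_measure_sphere K])
       (use cone_measure_cball_le[where 'a='a] in \<open>auto simp: K_def m_def\<close>)
  also have "\<dots> \<le> hausdorff_outer m (sphere (0::'a) 1)" by (rule hausdorff_pre_le_outer) simp
  finally show ?thesis by (simp add: m_def)
qed

section \<open>The area measure is proportional to the cone measure\<close>

lemma emeasure_sphere_area:
  assumes "A \<in> sets borel"
  shows "emeasure sphere_area (A \<inter> sphere 0 1)
    = hausdorff_outer (CARD('n) - 1) (A \<inter> sphere (0 :: real ^ 'n) 1)"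
  unfolding sphere_area_def using assms
  by (subst emeasure_restrict_space) (auto simp: emeasure_hausdorff_measure)

lemma emeasure_sphere_area_sphere:
  "emeasure sphere_area (sphere (0 :: real ^ 'n) 1) = ennreal (measure sphere_area (sphere (0 :: real ^ 'n) 1))"
  "0 < measure sphere_area (sphere (0 :: real ^ 'n) 1)"
proof -
  have eq: "emeasure sphere_area (sphere (0 :: real ^ 'n) 1)
      = hausdorff_outer (DIM(real ^ 'n) - 1) (sphere (0 :: real ^ 'n) 1)"
    using emeasure_sphere_area[of "UNIV :: (real ^ 'n) set"] by simp
  then show *: "emeasure sphere_area (sphere (0 :: real ^ 'n) 1) = ennreal (measure sphere_area (sphere (0 :: real ^ 'n) 1))"
    using hausdorff_outer_sphere_finite[where 'a="real ^ 'n"]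
    by (intro emeasure_eq_ennreal_measure) auto
  show "0 < measure sphere_area (sphere (0 :: real ^ 'n) 1)"
    using hausdorff_outer_sphere_pos[where 'a="real ^ 'n"] unfolding eq[symmetric] * by simp
qed

text \<open>
  Both measures are invariant under orthogonal maps, which act transitively on the sphere, so
  \<open>uniform_measures_eq\<close> applies once the area has been scaled to have the total mass of the cone
  measure, the volume of the unit ball.
\<close>

proposition nn_integral_cone_measure_eq_sphere_area:
  fixes g :: "real ^ 'n \<Rightarrow> ennreal"
  assumes [measurable]: "g \<in> borel_measurable borel"
  shows "(\<integral>\<^sup>+x. g x \<partial>cone_measure)
    = ennreal (unit_ball_vol (real CARD('n)) / measure sphere_area (sphere (0 :: real ^ 'n) 1))
      * (\<integral>\<^sup>+x. g x \<partial>sphere_area)"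
proof -
  let ?S = "sphere (0 :: real ^ 'n) 1"
  define H where "H = (hausdorff_measure (CARD('n) - 1) :: (real ^ 'n) measure)"
  define c where "c = unit_ball_vol (real CARD('n)) / measure sphere_area ?S"
  define \<nu> where "\<nu> = density H (\<lambda>x. ennreal c * indicator ?S x)"
  have c: "0 < c" using emeasure_sphere_area_sphere(2)[where 'n='n] by (simp add: c_def)
  have sets [measurable_cong]: "sets H = sets borel" "sets \<nu> = sets borel" by (simp_all add: H_def \<nu>_def)
  have [measurable]: "indicator ?S \<in> borel_measurable H"
    by (intro borel_measurable_indicator) (simp add: sets)
  have \<nu>: "emeasure \<nu> A = ennreal c * hausdorff_outer (CARD('n) - 1) (?S \<inter> A)"
    if [measurable]: "A \<in> sets borel" for A
  proof -
    have "emeasure \<nu> A = (\<integral>\<^sup>+x. ennreal c * indicator ?S x * indicator A x \<partial>H)"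
      unfolding \<nu>_def using that by (intro emeasure_density) (simp_all add: sets)
    also have "\<dots> = (\<integral>\<^sup>+x. ennreal c * indicator (?S \<inter> A) x \<partial>H)"
      by (intro nn_integral_cong) (simp add: indicator_def)
    also have "\<dots> = ennreal c * emeasure H (?S \<inter> A)"
      using that by (intro nn_integral_cmult_indicator) (simp add: sets)
    finally show ?thesis using that by (simp add: H_def emeasure_hausdorff_measure)
  qed
  have "\<nu> = cone_measure"
  proof (rule uniform_measures_eq[where S="?S"])
    have "hausdorff_outer (CARD('n) - 1) ?S = ennreal (measure sphere_area ?S)"
      using emeasure_sphere_area[of "UNIV :: (real ^ 'n) set"] emeasure_sphere_area_sphere(1)[where 'n='n]
      by simp
    then have total: "emeasure \<nu> UNIV = ennreal (unit_ball_vol (real CARD('n)))"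
      using c emeasure_sphere_area_sphere(2)[where 'n='n]
      by (simp add: \<nu> ennreal_mult[symmetric] c_def)
    then show "emeasure \<nu> UNIV = emeasure (cone_measure :: (real ^ 'n) measure) UNIV"
      "0 < emeasure \<nu> UNIV" "emeasure \<nu> UNIV < \<infinity>"
      by (simp_all add: emeasure_cone_measure_UNIV)
    show "AE x in \<nu>. x \<in> ?S"
      unfolding \<nu>_def by (subst AE_density) (auto simp: indicator_def)
    fix u v :: "real ^ 'n" and r
    assume uv: "u \<in> ?S" "v \<in> ?S"
    then have "norm u = norm v" by simp
    then obtain T where T: "orthogonal_transformation T" "T u = v"
      by (rule orthogonal_transformation_exists)
    from cone_measure_ball_orthogonal[OF T(1), of u r]
    show "emeasure cone_measure (ball u r) = emeasure cone_measure (ball v r)"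
      using T(2) by simp
    have le: "emeasure \<nu> (ball (R a) r) \<le> emeasure \<nu> (ball a r)"
      if R: "orthogonal_transformation R" for R and a :: "real ^ 'n"
    proof -
      have iso: "dist (R x) (R y) = dist x y" for x y
        using R by (simp add: orthogonal_transformation_isometry)
      have "?S \<inter> ball (R a) r = R ` (?S \<inter> ball a r)"
      proof safe
        fix y assume y: "y \<in> ?S" "y \<in> ball (R a) r"
        obtain x where "y = R x" using orthogonal_transformation_surj[OF R] by blast
        with y show "y \<in> R ` (?S \<inter> ball a r)"
          by (auto simp: iso orthogonal_transformation_norm[OF R])
      qed (auto simp: iso orthogonal_transformation_norm[OF R])
      then show ?thesis
        by (simp add: \<nu> hausdorff_outer_isometric_image_le iso mult_left_mono)
    qed
    have "inv T v = u" using T orthogonal_transformation_inj by (metis inv_f_f)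
    then show "emeasure \<nu> (ball u r) = emeasure \<nu> (ball v r)"
      using le[OF T(1), of u] le[OF orthogonal_transformation_inv[OF T(1)], of v] T(2)
      by (intro antisym) simp_all
  qed (simp_all only: sets sets_cone_measure AE_cone_measure_sphere)
  then have "(\<integral>\<^sup>+x. g x \<partial>cone_measure) = (\<integral>\<^sup>+x. g x \<partial>\<nu>)" by simp
  also have "\<dots> = (\<integral>\<^sup>+x. ennreal c * (g x * indicator ?S x) \<partial>H)"
    unfolding \<nu>_def by (subst nn_integral_density) (auto simp: mult_ac)
  also have "\<dots> = ennreal c * (\<integral>\<^sup>+x. g x * indicator ?S x \<partial>H)"
    by (intro nn_integral_cmult) measurable
  also have "(\<integral>\<^sup>+x. g x * indicator ?S x \<partial>H) = (\<integral>\<^sup>+x. g x \<partial>sphere_area)"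
    unfolding sphere_area_def H_def[symmetric] by (subst nn_integral_restrict_space) (auto simp: sets)
  finally show ?thesis by (simp add: c_def)
qed

section \<open>Polar coordinates\<close>

lemma nn_integral_lborel_scaleR:
  fixes f :: "'a::euclidean_space \<Rightarrow> ennreal"
  assumes [measurable]: "f \<in> borel_measurable borel" and "0 < c"
  shows "(\<integral>\<^sup>+x. f x \<partial>lborel) = ennreal (c ^ DIM('a)) * (\<integral>\<^sup>+x. f (c *\<^sub>R x) \<partial>lborel)"
proof -
  have "(\<integral>\<^sup>+x. f x \<partial>lborel)
      = (\<integral>\<^sup>+x. f x \<partial>density (distr lborel borel (\<lambda>x. 0 + c *\<^sub>R x)) (\<lambda>_. ennreal (\<bar>c\<bar> ^ DIM('a))))"
    using lborel_affine[of c "0::'a"] \<open>0 < c\<close> by simp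
  also have "\<dots> = ennreal (c ^ DIM('a)) * (\<integral>\<^sup>+x. f (c *\<^sub>R x) \<partial>lborel)"
    using \<open>0 < c\<close> by (simp add: nn_integral_density nn_integral_distr nn_integral_cmult)
  finally show ?thesis .
qed

lemma nn_integral_power_density:
  assumes "0 < n" "0 \<le> a"
  shows "(\<integral>\<^sup>+r. indicator {0..} r * ennreal (real n * r ^ (n - 1)) * indicator {..<a} r \<partial>lborel) = ennreal (a ^ n)"
proof -
  have "(\<integral>\<^sup>+r. indicator {0..} r * ennreal (real n * r ^ (n - 1)) * indicator {..<a} r \<partial>lborel)
      = (\<integral>\<^sup>+r. ennreal (real n * r ^ (n - 1)) * indicator {0..a} r \<partial>lborel)"
  proof (rule nn_integral_cong_AE)
    have "AE r in lborel. r \<noteq> a" by (rule AE_lborel_singleton)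
    then show "AE r in lborel. indicator {0..} r * ennreal (real n * r ^ (n - 1)) * indicator {..<a} r
        = ennreal (real n * r ^ (n - 1)) * indicator {0..a} r"
      by eventually_elim (auto simp: indicator_def)
  qed
  also have "\<dots> = ennreal (a ^ n - 0 ^ n)"
    using assms by (intro nn_integral_FTC_Icc) (auto intro!: derivative_eq_intros)
  finally show ?thesis using \<open>0 < n\<close> by (simp only: zero_power diff_zero)
qed

text \<open>
  Push the measure with density \<open>g (x / |x|)\<close> forward under the norm.  By scaling, the ball of radius
  \<open>a\<close> has mass \<open>a\<^sup>n\<close> times that of the unit ball, and a measure on the line is determined by its
  values on the half-lines \<open>{..<a}\<close>.  Finiteness of the integral of \<open>g\<close> enters through this
  uniqueness.
\<close>

proposition nn_integral_polar:
  fixes g :: "'a::euclidean_space \<Rightarrow> ennreal" and h :: "real \<Rightarrow> ennreal"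
  assumes g [measurable]: "g \<in> borel_measurable borel" and [measurable]: "h \<in> borel_measurable borel"
    and fin: "(\<integral>\<^sup>+x. g x \<partial>cone_measure) < \<infinity>"
  shows "(\<integral>\<^sup>+x. g (sgn x) * h (norm x) \<partial>lborel) = (\<integral>\<^sup>+x. g x \<partial>cone_measure) *
    (\<integral>\<^sup>+r. indicator {0..} r * ennreal (real DIM('a) * r ^ (DIM('a) - 1)) * h r \<partial>lborel)"
proof -
  define n G where "n = DIM('a)" and "G = (\<integral>\<^sup>+x. g x \<partial>cone_measure)"
  have "0 < n" by (simp add: n_def)
  define M1 where "M1 = distr (density lborel (\<lambda>x. g (sgn x))) borel norm"
  define w where "w r = indicator {0..} r * ennreal (real n * r ^ (n - 1))" for r :: real
  have [measurable]: "w \<in> borel_measurable borel" unfolding w_def by measurable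
  define M2 where "M2 = density lborel (\<lambda>r. G * w r)"
  have M1: "emeasure M1 {..<a} = G * ennreal (max 0 a ^ n)" for a
  proof -
    have "emeasure M1 {..<a} = emeasure (density lborel (\<lambda>x. g (sgn x))) (norm -` {..<a})"
      unfolding M1_def by (subst emeasure_distr) auto
    also have "norm -` {..<a} = ball (0::'a) a" by auto
    also have "emeasure (density lborel (\<lambda>x. g (sgn x))) (ball 0 a)
        = (\<integral>\<^sup>+x. g (sgn x) * indicator (ball 0 a) x \<partial>lborel)"
      by (intro emeasure_density) auto
    also have "\<dots> = G * ennreal (max 0 a ^ n)"
    proof (cases "0 < a")
      case True
      have [measurable]: "ball (0::'a) a \<in> sets borel" by simp
      have "(\<integral>\<^sup>+x. g (sgn x) * indicator (ball 0 a) x \<partial>lborel)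
          = ennreal (a ^ n) * (\<integral>\<^sup>+x. g (sgn (a *\<^sub>R x)) * indicator (ball 0 a) (a *\<^sub>R x) \<partial>lborel)"
        unfolding n_def using True by (intro nn_integral_lborel_scaleR) measurable
      also have "(\<integral>\<^sup>+x. g (sgn (a *\<^sub>R x)) * indicator (ball 0 a) (a *\<^sub>R x) \<partial>lborel)
          = (\<integral>\<^sup>+x. indicator (ball 0 1) x * g (sgn x) \<partial>lborel)"
        using True by (intro nn_integral_cong) (simp add: indicator_def sgn_scaleR)
      finally show ?thesis using True by (simp add: G_def nn_integral_cone_measure mult.commute)
    next
      case False
      then have empty: "ball (0::'a) a = {}" by (simp add: ball_empty)
      show ?thesis unfolding empty using False \<open>0 < n\<close> by (simp add: zero_power)
    qed
    finally show ?thesis .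
  qed
  have M2: "emeasure M2 {..<a} = G * ennreal (max 0 a ^ n)" for a
  proof -
    have "emeasure M2 {..<a} = (\<integral>\<^sup>+r. G * (w r * indicator {..<a} r) \<partial>lborel)"
      unfolding M2_def by (subst emeasure_density) (auto simp: mult_ac)
    also have "\<dots> = G * (\<integral>\<^sup>+r. w r * indicator {..<a} r \<partial>lborel)"
      by (intro nn_integral_cmult) auto
    also have "(\<integral>\<^sup>+r. w r * indicator {..<a} r \<partial>lborel) = (\<integral>\<^sup>+r. w r * indicator {..<max 0 a} r \<partial>lborel)"
      by (intro nn_integral_cong) (auto simp: w_def indicator_def)
    also have "\<dots> = ennreal (max 0 a ^ n)"
      unfolding w_def using \<open>0 < n\<close> by (intro nn_integral_power_density) auto
    finally show ?thesis .
  qed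
  have "M1 = M2"
  proof (rule measure_eqI_generator_eq[where \<Omega>=UNIV and E="range lessThan" and A="\<lambda>i. {..<real i}"])
    have "{..<a} \<inter> {..<b} = {..<min a b}" for a b :: real by auto
    then show "Int_stable (range (lessThan :: real \<Rightarrow> real set))"
      by (auto simp: Int_stable_def)
    show "sets M1 = sigma_sets UNIV (range lessThan)" "sets M2 = sigma_sets UNIV (range lessThan)"
      by (simp_all add: M1_def M2_def borel_Iio)
    show "(\<Union>i. {..<real i}) = UNIV" using reals_Archimedean2 by auto
    show "emeasure M1 {..<real i} \<noteq> \<infinity>" for i
      using fin by (simp add: M1 G_def ennreal_mult_eq_top_iff less_top[symmetric])
  qed (auto simp: M1 M2)
  have "(\<integral>\<^sup>+x. g (sgn x) * h (norm x) \<partial>lborel) = (\<integral>\<^sup>+r. h r \<partial>M1)"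
    unfolding M1_def by (simp add: nn_integral_distr nn_integral_density)
  also have "\<dots> = (\<integral>\<^sup>+r. G * (w r * h r) \<partial>lborel)"
    unfolding \<open>M1 = M2\<close> unfolding M2_def by (simp add: nn_integral_density mult_ac)
  also have "\<dots> = G * (\<integral>\<^sup>+r. w r * h r \<partial>lborel)"
    by (intro nn_integral_cmult) auto
  finally show ?thesis by (simp add: G_def w_def n_def)
qed

section \<open>The law of a Gaussian vector\<close>

lemma bij_betw_axis_Basis: "bij_betw (\<lambda>i. axis i (1::real)) UNIV (Basis :: (real ^ 'n) set)"
  by (auto simp: bij_betw_def inj_on_def axis_eq_axis Basis_vec_def)

lemma gaussian_density_prod:
  fixes x :: "'a::euclidean_space"
  shows "(\<Prod>b\<in>Basis. ennreal (1 / sqrt pi * exp (- (x \<bullet> b)\<^sup>2)))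
    = ennreal ((1 / sqrt pi) ^ DIM('a) * exp (- (norm x)\<^sup>2))"
proof -
  have "(\<Sum>b\<in>Basis. (x \<bullet> b)\<^sup>2) = (norm x)\<^sup>2"
    unfolding power2_norm_eq_inner by (subst (2) euclidean_inner) (simp add: power2_eq_square)
  then have "(\<Prod>b\<in>Basis. exp (- (x \<bullet> b)\<^sup>2)) = exp (- (norm x)\<^sup>2)"
    by (simp add: exp_sum[symmetric] sum_negf)
  then have "(\<Prod>b\<in>Basis. 1 / sqrt pi * exp (- (x \<bullet> b)\<^sup>2)) = (1 / sqrt pi) ^ DIM('a) * exp (- (norm x)\<^sup>2)"
    by (simp only: prod.distrib prod_constant)
  then show ?thesis
    by (subst prod_ennreal) simp_all
qed

text \<open>
  Both sides are finite measures, so it is enough to compare them on boxes, where independence on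
  one side and Fubini's theorem on the other produce the same product of one-dimensional integrals.
\<close>

lemma distr_gaussian_vector:
  fixes X :: "'n::finite \<Rightarrow> 'b \<Rightarrow> real"
  assumes M: "prob_space M" and indep: "prob_space.indep_vars M (\<lambda>_. borel) X UNIV"
    and X: "\<And>i. distributed M lborel (X i) (\<lambda>x. ennreal (1 / sqrt pi * exp (- x\<^sup>2)))"
  shows "distr M borel (\<lambda>\<omega>. \<chi> i. X i \<omega>) =
    density lborel (\<lambda>x :: real ^ 'n. ennreal ((1 / sqrt pi) ^ CARD('n) * exp (- (norm x)\<^sup>2)))"
proof -
  interpret prob_space M by fact
  define \<phi> where "\<phi> x = ennreal (1 / sqrt pi * exp (- x\<^sup>2))" for x :: real
  have [measurable]: "\<phi> \<in> borel_measurable borel" unfolding \<phi>_def by measurable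
  have Xm [measurable]: "X i \<in> borel_measurable M" for i
    using X[of i] by (auto simp: distributed_def)
  have Y: "(\<lambda>\<omega>. \<chi> i. X i \<omega>) \<in> borel_measurable M"
    by (subst borel_measurable_euclidean_space) (auto simp: Basis_vec_def inner_axis)
  define D where "D = density lborel (\<lambda>x :: real ^ 'n. ennreal ((1 / sqrt pi) ^ CARD('n) * exp (- (norm x)\<^sup>2)))"
  show ?thesis
    unfolding D_def[symmetric]
  proof (rule measure_eqI_generator_eq[where \<Omega>=UNIV and E="range (\<lambda>(a, b). box a b :: (real ^ 'n) set)"
        and A="\<lambda>n. box (- (real n *\<^sub>R One)) (real n *\<^sub>R One)"])
    show "Int_stable (range (\<lambda>(a, b). box a b :: (real ^ 'n) set))"
      by (auto simp: Int_stable_def box_Int_box)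
    show "sets (distr M borel (\<lambda>\<omega>. \<chi> i. X i \<omega>)) = sigma_sets UNIV (range (\<lambda>(a, b). box a b :: (real ^ 'n) set))"
      "sets D = sigma_sets UNIV (range (\<lambda>(a, b). box a b :: (real ^ 'n) set))"
      by (simp_all add: D_def borel_eq_box)
    show "(\<Union>n. box (- (real n *\<^sub>R One)) (real n *\<^sub>R One)) = (UNIV :: (real ^ 'n) set)"
      by (rule UN_box_eq_UNIV)
    fix U :: "(real ^ 'n) set" assume "U \<in> range (\<lambda>(a, b). box a b)"
    then obtain a b where U: "U = box a b" by auto
    let ?I = "\<lambda>i. {a $ i <..< b $ i}"
    have "emeasure (distr M borel (\<lambda>\<omega>. \<chi> i. X i \<omega>)) U = emeasure M (\<Inter>i\<in>UNIV. X i -` ?I i \<inter> space M)"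
      using Y by (subst emeasure_distr) (auto simp: U mem_box_cart intro!: arg_cong[where f="emeasure M"])
    also have "\<dots> = ennreal (\<Prod>i\<in>UNIV. prob (X i -` ?I i \<inter> space M))"
      using indep by (subst emeasure_eq_measure, subst indep_varsD) auto
    also have "\<dots> = (\<Prod>i\<in>UNIV. emeasure M (X i -` ?I i \<inter> space M))"
      by (simp add: emeasure_eq_measure prod_ennreal)
    also have "\<dots> = (\<Prod>i\<in>UNIV. \<integral>\<^sup>+t. \<phi> t * indicator (?I i) t \<partial>lborel)"
    proof (rule prod.cong)
      fix i
      show "emeasure M (X i -` ?I i \<inter> space M) = (\<integral>\<^sup>+t. \<phi> t * indicator (?I i) t \<partial>lborel)"
        unfolding \<phi>_def using X[of i] by (rule distributed_emeasure) simp
    qed simp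
    also have "\<dots> = (\<Prod>c\<in>Basis. \<integral>\<^sup>+t. \<phi> t * indicator {a \<bullet> c <..< b \<bullet> c} t \<partial>lborel)"
      by (subst prod.reindex_bij_betw[OF bij_betw_axis_Basis, symmetric]) (simp add: cart_eq_inner_axis)
    also have "\<dots> = (\<integral>\<^sup>+x. (\<Prod>c\<in>Basis. \<phi> (x \<bullet> c) * indicator {a \<bullet> c <..< b \<bullet> c} (x \<bullet> c)) \<partial>(lborel :: (real ^ 'n) measure))"
      by (rule nn_integral_lborel_prod[symmetric]) auto
    also have "\<dots> = (\<integral>\<^sup>+x. ennreal ((1 / sqrt pi) ^ CARD('n) * exp (- (norm x)\<^sup>2)) * indicator U x \<partial>lborel)"
    proof (rule nn_integral_cong)
      fix x :: "real ^ 'n"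
      have "(\<Prod>c\<in>Basis. indicator {a \<bullet> c <..< b \<bullet> c} (x \<bullet> c)) = (indicator U x :: ennreal)"
        by (auto simp: U mem_box indicator_def)
      then show "(\<Prod>c\<in>Basis. \<phi> (x \<bullet> c) * indicator {a \<bullet> c <..< b \<bullet> c} (x \<bullet> c))
          = ennreal ((1 / sqrt pi) ^ CARD('n) * exp (- (norm x)\<^sup>2)) * indicator U x"
        using gaussian_density_prod[of x] by (simp add: \<phi>_def prod.distrib)
    qed
    also have "\<dots> = emeasure D U"
      unfolding D_def U by (subst emeasure_density) auto
    finally show "emeasure (distr M borel (\<lambda>\<omega>. \<chi> i. X i \<omega>)) U = emeasure D U" .
  next
    fix n show "emeasure (distr M borel (\<lambda>\<omega>. \<chi> i. X i \<omega>)) (box (- (real n *\<^sub>R One)) (real n *\<^sub>R One)) \<noteq> \<infinity>"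
      using Y by (subst emeasure_distr) auto
  qed auto
qed

section \<open>Homogeneous functions of a Gaussian vector\<close>

text \<open>
  Euler's integral for \<open>\<Gamma> s\<close> after the substitution \<open>t = r\<^sup>2\<close>.
\<close>

lemma has_integral_gaussian_moment:
  fixes s :: real
  assumes "0 < s"
  shows "((\<lambda>r. 2 * r powr (2 * s - 1) * exp (- r\<^sup>2)) has_integral Gamma s) {0<..}"
proof -
  define f :: "real \<Rightarrow> real" where "f t = t powr (s - 1) / exp t" for t
  have img: "(\<lambda>r::real. r\<^sup>2) ` {0<..} = {0<..}"
  proof safe
    fix t :: real assume "0 < t"
    then show "t \<in> (\<lambda>r. r\<^sup>2) ` {0<..}" by (intro image_eqI[of _ _ "sqrt t"]) auto
  qed auto
  have "(f has_integral Gamma s) {0<..}"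
  proof -
    have "(f has_integral Gamma s) {0..}" unfolding f_def by (rule Gamma_integral_real) fact
    moreover have "(f has_integral Gamma s) {0..} \<longleftrightarrow> (f has_integral Gamma s) {0<..}"
      by (rule has_integral_spike_set_eq; rule negligible_subset[of "{0}"]) auto
    ultimately show ?thesis by simp
  qed
  moreover have "f absolutely_integrable_on {0<..}"
    using \<open>(f has_integral Gamma s) {0<..}\<close>
    by (intro nonnegative_absolutely_integrable_1) (auto simp: f_def integrable_on_def)
  ultimately have "f absolutely_integrable_on (\<lambda>r. r\<^sup>2) ` {0<..} \<and> integral ((\<lambda>r. r\<^sup>2) ` {0<..}) f = Gamma s"
    unfolding img by (auto intro: integral_unique)
  moreover have "(\<lambda>r. \<bar>2 * r\<bar> * f (r\<^sup>2)) absolutely_integrable_on {0<..} \<and>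
      integral {0<..} (\<lambda>r. \<bar>2 * r\<bar> * f (r\<^sup>2)) = Gamma s \<longleftrightarrow>
      f absolutely_integrable_on (\<lambda>r. r\<^sup>2) ` {0<..} \<and> integral ((\<lambda>r. r\<^sup>2) ` {0<..}) f = Gamma s"
    by (rule has_absolute_integral_change_of_variables_1')
       (auto intro!: derivative_eq_intros inj_onI)
  ultimately have "(\<lambda>r. \<bar>2 * r\<bar> * f (r\<^sup>2)) absolutely_integrable_on {0<..} \<and>
      integral {0<..} (\<lambda>r. \<bar>2 * r\<bar> * f (r\<^sup>2)) = Gamma s"
    by blast
  then have "((\<lambda>r. \<bar>2 * r\<bar> * f (r\<^sup>2)) has_integral Gamma s) {0<..}"
    by (auto simp: absolutely_integrable_on_def has_integral_integral)
  then show ?thesis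
  proof (rule has_integral_eq[rotated])
    fix r :: real assume "r \<in> {0<..}"
    then have r: "0 < r" by simp
    have "r\<^sup>2 powr (s - 1) = r powr (2 * (s - 1))"
      using r by (simp add: powr_powr flip: powr_numeral)
    moreover have "r * r powr (2 * (s - 1)) = r powr (2 * s - 1)"
      using r powr_add[of r 1 "2 * (s - 1)"] by (simp add: algebra_simps)
    ultimately show "\<bar>2 * r\<bar> * f (r\<^sup>2) = 2 * r powr (2 * s - 1) * exp (- r\<^sup>2)"
      using r by (simp add: f_def exp_minus field_simps)
  qed
qed

text \<open>
  The theorem for functions with values in \<open>[0, \<infinity>]\<close>.  Polar coordinates leave the radial
  integral of \<open>r powr (n + d - 1) * exp (- r\<^sup>2)\<close>, which is half of \<open>\<Gamma>((n + d) / 2)\<close>; the condition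
  \<open>n + d > 0\<close> is exactly its convergence at the origin.  The remaining constants collapse
  because the unit ball has volume \<open>\<pi>\<^sup>n\<^sup>/\<^sup>2 / \<Gamma>(n / 2 + 1)\<close>.
\<close>

proposition nn_integral_gaussian_homogeneous:
  fixes g :: "real ^ 'n \<Rightarrow> ennreal" and d :: real
  assumes nd: "real CARD('n) + d > 0" and g [measurable]: "g \<in> borel_measurable borel"
    and hom: "\<And>c x. 0 < c \<Longrightarrow> x \<noteq> 0 \<Longrightarrow> g (c *\<^sub>R x) = ennreal (c powr d) * g x"
    and fin: "(\<integral>\<^sup>+x. g x \<partial>sphere_area) < \<infinity>"
  shows "(\<integral>\<^sup>+x. g x \<partial>density lborel (\<lambda>x. ennreal ((1 / sqrt pi) ^ CARD('n) * exp (- (norm x)\<^sup>2))))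
    = ennreal (Gamma ((real CARD('n) + d) / 2) / Gamma (real CARD('n) / 2)
        / measure sphere_area (sphere (0 :: real ^ 'n) 1)) * (\<integral>\<^sup>+x. g x \<partial>sphere_area)"
proof -
  define n s A C where "n = CARD('n)" and "s = (real n + d) / 2"
    and "A = measure sphere_area (sphere (0 :: real ^ 'n) 1)" and "C = (1 / sqrt pi) ^ n"
  have pos: "0 < n" "0 < s" "0 < A" "0 < C"
    using nd emeasure_sphere_area_sphere(2)[where 'n='n] by (auto simp: n_def s_def A_def C_def)
  define \<omega> where "\<omega> = unit_ball_vol (real n)"
  have "0 < \<omega>" by (simp add: \<omega>_def)
  have cone: "(\<integral>\<^sup>+x. g x \<partial>cone_measure) = ennreal (\<omega> / A) * (\<integral>\<^sup>+x. g x \<partial>sphere_area)"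
    unfolding \<omega>_def A_def n_def by (rule nn_integral_cone_measure_eq_sphere_area) fact
  \<comment> \<open>The radial factor: the homogeneity \<open>|x| powr d\<close> times the Gaussian density.\<close>
  define h where "h r = ennreal (C * (r powr d * exp (- r\<^sup>2)))" for r
  have [measurable]: "h \<in> borel_measurable borel" unfolding h_def by measurable
  have "(\<integral>\<^sup>+x. g x \<partial>density lborel (\<lambda>x. ennreal (C * exp (- (norm x)\<^sup>2))))
      = (\<integral>\<^sup>+x. ennreal (C * exp (- (norm x)\<^sup>2)) * g x \<partial>lborel)"
    by (intro nn_integral_density) auto
  also have "\<dots> = (\<integral>\<^sup>+x. g (sgn x) * h (norm x) \<partial>lborel)"
  proof (rule nn_integral_cong_AE)
    have "AE x in lborel. x \<noteq> (0 :: real ^ 'n)" by (rule AE_lborel_singleton)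
    then show "AE x in lborel. ennreal (C * exp (- (norm x)\<^sup>2)) * g x = g (sgn x) * h (norm x)"
    proof eventually_elim
      case (elim x)
      have "g x = g (norm x *\<^sub>R sgn x)" using elim by (simp add: sgn_div_norm)
      also have "\<dots> = ennreal (norm x powr d) * g (sgn x)"
        using elim by (intro hom) (auto simp: sgn_zero_iff)
      finally have "ennreal (C * exp (- (norm x)\<^sup>2)) * g x
          = (ennreal (C * exp (- (norm x)\<^sup>2)) * ennreal (norm x powr d)) * g (sgn x)"
        by (simp add: mult.assoc)
      also have "ennreal (C * exp (- (norm x)\<^sup>2)) * ennreal (norm x powr d) = h (norm x)"
        using pos by (simp add: h_def ennreal_mult[symmetric] mult_ac)
      finally show ?case by (simp add: mult.commute)
    qed
  qed
  also have "\<dots> = (\<integral>\<^sup>+x. g x \<partial>cone_measure) *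
      (\<integral>\<^sup>+r. indicator {0..} r * ennreal (real n * r ^ (n - 1)) * h r \<partial>lborel)"
    using nn_integral_polar[of g h] fin by (simp add: cone ennreal_mult_less_top n_def)
  also have "(\<integral>\<^sup>+r. indicator {0..} r * ennreal (real n * r ^ (n - 1)) * h r \<partial>lborel)
      = (\<integral>\<^sup>+r. ennreal (real n * C / 2 * (2 * r powr (2 * s - 1) * exp (- r\<^sup>2))) * indicator {0<..} r \<partial>lborel)"
  proof (rule nn_integral_cong_AE)
    have "AE r in lborel. r \<noteq> (0::real)" by (rule AE_lborel_singleton)
    then show "AE r in lborel. indicator {0..} r * ennreal (real n * r ^ (n - 1)) * h r
        = ennreal (real n * C / 2 * (2 * r powr (2 * s - 1) * exp (- r\<^sup>2))) * indicator {0<..} r"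
    proof eventually_elim
      case (elim r)
      show ?case
      proof (cases "0 < r")
        case True
        have "real (n - 1) + d = 2 * s - 1" using pos by (simp add: s_def of_nat_diff)
        then have "r ^ (n - 1) * r powr d = r powr (2 * s - 1)"
          using True by (simp add: powr_realpow[symmetric] powr_add[symmetric])
        moreover have "real n * r ^ (n - 1) * (C * (r powr d * exp (- r\<^sup>2)))
            = real n * C * (r ^ (n - 1) * r powr d) * exp (- r\<^sup>2)"
          by (simp only: mult_ac)
        ultimately have "real n * r ^ (n - 1) * (C * (r powr d * exp (- r\<^sup>2)))
            = real n * C / 2 * (2 * r powr (2 * s - 1) * exp (- r\<^sup>2))"
          by simp
        then show ?thesis
          using True pos by (simp add: h_def ennreal_mult[symmetric])
      qed (use elim in \<open>auto simp: indicator_def\<close>)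
    qed
  qed
  also have "\<dots> = ennreal (real n * C / 2 * Gamma s)"
    using pos has_integral_mult_right[OF has_integral_gaussian_moment[OF pos(2)], of "real n * C / 2"]
    by (intro nn_integral_has_integral_lebesgue') auto
  also have "(\<integral>\<^sup>+x. g x \<partial>cone_measure) * ennreal (real n * C / 2 * Gamma s)
      = ennreal (\<omega> / A * (real n * C / 2 * Gamma s)) * (\<integral>\<^sup>+x. g x \<partial>sphere_area)"
    using pos \<open>0 < \<omega>\<close> by (subst ennreal_mult[of "\<omega> / A"]) (simp_all add: cone mult_ac)
  also have "\<omega> / A * (real n * C / 2 * Gamma s) = Gamma s / Gamma (real n / 2) / A"
  proof -
    have "Gamma (real n / 2 + 1) = real n / 2 * Gamma (real n / 2)"
      using pos by (intro Gamma_plus1) (auto dest: nonpos_Ints_nonpos)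
    moreover have "pi powr (real n / 2) * C = 1"
    proof -
      have "pi powr (real n / 2) = sqrt pi ^ n"
        by (simp add: powr_half_sqrt[symmetric] powr_powr flip: powr_realpow)
      then show ?thesis by (simp add: C_def power_one_over)
    qed
    moreover have "0 < Gamma (real n / 2)" using pos by simp
    ultimately have "\<omega> * (real n * C / 2) = 1 / Gamma (real n / 2)"
      using pos by (simp add: \<omega>_def unit_ball_vol_def field_simps)
    moreover have "\<omega> / A * (real n * C / 2 * Gamma s) = \<omega> * (real n * C / 2) * (Gamma s / A)" by simp
    ultimately show ?thesis by simp
  qed
  finally show ?thesis by (simp add: n_def s_def A_def C_def)
qed

theorem theorem3:
  fixes f :: "real ^ 'n \<Rightarrow> real"
    and d :: real
    and M :: "'b measure"
    and X :: "'n \<Rightarrow> 'b \<Rightarrow> real"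
  assumes "real CARD('n) + d > 0"
    and "f \<in> borel_measurable (restrict_space borel (- {0}))"
    and "\<And>c x. c > 0 \<Longrightarrow> x \<noteq> 0 \<Longrightarrow> f (c *\<^sub>R x) = c powr d * f x"
    and "integrable sphere_area f"
    and "prob_space M"
    and "prob_space.indep_vars M (\<lambda>_. borel) X UNIV"
    and "\<And>i. distributed M lborel (X i) (\<lambda>x. ennreal (1 / sqrt pi * exp (- x\<^sup>2)))"
  shows "integrable M (\<lambda>\<omega>. f (\<chi> i. X i \<omega>)) \<and>
         Gamma ((real CARD('n) + d) / 2) * sphere_average f =
           Gamma (real CARD('n) / 2) * (\<integral>\<omega>. f (\<chi> i. X i \<omega>) \<partial>M)"
proof -
  note nd = assms(1) and f_meas = assms(2) and hom = assms(3) and f_int = assms(4)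
  let ?Y = "\<lambda>\<omega>. \<chi> i. X i \<omega>"
  define D where "D = density lborel (\<lambda>x :: real ^ 'n. ennreal ((1 / sqrt pi) ^ CARD('n) * exp (- (norm x)\<^sup>2)))"
  define A where "A = measure sphere_area (sphere (0 :: real ^ 'n) 1)"
  define k where "k = Gamma ((real CARD('n) + d) / 2) / Gamma (real CARD('n) / 2) / A"
  have "0 < A" using emeasure_sphere_area_sphere(2)[where 'n='n] by (simp add: A_def)
  have Gammas: "0 < Gamma ((real CARD('n) + d) / 2)" "0 < Gamma (real CARD('n) / 2)"
    using nd by simp_all
  have "0 < k" using \<open>0 < A\<close> Gammas by (simp add: k_def)
  have [measurable]: "f \<in> borel_measurable borel"
  proof -
    have "(\<lambda>x. indicator (- {0}) x *\<^sub>R f x) \<in> borel_measurable borel"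
      using f_meas by (subst (asm) borel_measurable_restrict_space_iff) auto
    then have "(\<lambda>x. indicator (- {0}) x *\<^sub>R f x + indicator {0} x * f 0) \<in> borel_measurable borel"
      by measurable
    also have "(\<lambda>x. indicator (- {0}) x *\<^sub>R f x + indicator {0} x * f 0) = f"
      by (auto simp: indicator_def)
    finally show ?thesis .
  qed
  have Y [measurable]: "?Y \<in> borel_measurable M"
    using assms(7) by (subst borel_measurable_euclidean_space)
      (auto simp: Basis_vec_def inner_axis distributed_def)
  have law: "distr M borel ?Y = D"
    unfolding D_def using assms(5-7) by (rule distr_gaussian_vector)
  have abs_fin: "(\<integral>\<^sup>+x. ennreal \<bar>f x\<bar> \<partial>sphere_area) < \<infinity>"
    using f_int by (simp add: integrable_iff_bounded)
  \<comment> \<open>Used with the identity, negation and absolute value for \<open>u\<close>, all positively homogeneous of degree 1.\<close>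
  have E: "(\<integral>\<^sup>+\<omega>. ennreal (u (f (?Y \<omega>))) \<partial>M) = ennreal k * (\<integral>\<^sup>+x. ennreal (u (f x)) \<partial>sphere_area)"
    if [measurable]: "u \<in> borel_measurable borel"
      and u: "\<And>c y. 0 < c \<Longrightarrow> u (c * y) = c * u y" "\<And>y. u y \<le> \<bar>y\<bar>" for u
  proof -
    have "(\<integral>\<^sup>+\<omega>. ennreal (u (f (?Y \<omega>))) \<partial>M) = (\<integral>\<^sup>+x. ennreal (u (f x)) \<partial>D)"
      unfolding law[symmetric] by (subst nn_integral_distr) auto
    also have "\<dots> = ennreal k * (\<integral>\<^sup>+x. ennreal (u (f x)) \<partial>sphere_area)"
      unfolding D_def k_def A_def
    proof (rule nn_integral_gaussian_homogeneous[OF nd])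
      show "ennreal (u (f (c *\<^sub>R x))) = ennreal (c powr d) * ennreal (u (f x))" if "0 < c" "x \<noteq> 0" for c x
        using that by (simp add: hom u ennreal_mult')
      have "(\<integral>\<^sup>+x. ennreal (u (f x)) \<partial>sphere_area) \<le> (\<integral>\<^sup>+x. ennreal \<bar>f x\<bar> \<partial>sphere_area)"
        by (intro nn_integral_mono ennreal_leI u)
      then show "(\<integral>\<^sup>+x. ennreal (u (f x)) \<partial>sphere_area) < \<infinity>"
        using abs_fin by (rule le_less_trans)
    qed measurable
    finally show ?thesis .
  qed
  have int: "integrable M (\<lambda>\<omega>. f (?Y \<omega>))"
  proof (rule integrableI_bounded)
    show "(\<integral>\<^sup>+\<omega>. ennreal (norm (f (?Y \<omega>))) \<partial>M) < \<infinity>"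
      using E[of abs] abs_fin by (simp add: abs_mult ennreal_mult_less_top)
  qed measurable
  have "(\<integral>\<omega>. f (?Y \<omega>) \<partial>M) = k * (\<integral>x. f x \<partial>sphere_area)"
    using E[of "\<lambda>y. y"] E[of uminus] \<open>0 < k\<close>
    by (simp add: real_lebesgue_integral_def[OF int] real_lebesgue_integral_def[OF f_int]
        enn2real_mult right_diff_distrib)
  then have "Gamma ((real CARD('n) + d) / 2) * sphere_average f = Gamma (real CARD('n) / 2) * (\<integral>\<omega>. f (?Y \<omega>) \<partial>M)"
    using Gammas[THEN less_imp_neq] \<open>0 < A\<close> by (simp add: sphere_average_def A_def k_def)
  with int show ?thesis by blast
qed

end
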